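(* There is an algorithm that, given a strongly chordal graph $G$ with $n\ge 3$ vertices and $m$ edges together with a strong elimination order of $G$, determines in $O(n+m)$ time whether $G$ has a locally connected spanning tree, and produces one if the answer is positive.
   Context: All graphs are finite and simple. A graph is chordal if every cycle of length greater than three has a chord; it is strongly chordal if it is chordal and every cycle of even length at least six has a chord dividing the cycle into two paths of odd length. For an ordering $(v_1,\ldots,v_n)$ of $V(G)$, $G_i$ is the subgraph induced by $\{v_i,\ldots,v_n\}$ and $N_{G_i}[v]$ is the closed neighborhood of $v$ in $G_i$. A strong elimination order is an ordering $(v_1,\ldots,v_n)$ of $V(G)$ such that $N_{G_i}[v_j]\subseteq N_{G_i}[v_k]$ whenever $i\le j\le k$ and $v_j,v_k\in N_{G_i}[v_i]$. A locally connected spanning tree of $G$ is a spanning tree $T$ of $G$ such that for every vertex $v$, the set of neighbors of $v$ in $T$ induces a connected subgraph of $G$. *)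

theory Defs
  imports Main
begin

section \<open>Graphs\<close>

definition simple_graph :: "'a set \<Rightarrow> 'a set set \<Rightarrow> bool" where
  "simple_graph V E \<longleftrightarrow> finite V \<and> (\<forall>e\<in>E. e \<subseteq> V \<and> card e = 2)"

definition neighbors :: "'a set set \<Rightarrow> 'a \<Rightarrow> 'a set" where
  "neighbors E v = {u. {u, v} \<in> E}"

definition closed_neighborhood :: "'a set set \<Rightarrow> 'a \<Rightarrow> 'a set" where
  "closed_neighborhood E v = insert v (neighbors E v)"

definition induced_edges :: "'a set set \<Rightarrow> 'a set \<Rightarrow> 'a set set" where
  "induced_edges E S = {e \<in> E. e \<subseteq> S}"

definition connected_graph :: "'a set \<Rightarrow> 'a set set \<Rightarrow> bool" where
  "connected_graph V E \<longleftrightarrow>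
     V \<noteq> {} \<and> (\<forall>u\<in>V. \<forall>v\<in>V. (u, v) \<in> {(x, y). {x, y} \<in> E}\<^sup>*)"

definition is_cycle :: "'a set set \<Rightarrow> 'a list \<Rightarrow> bool" where
  "is_cycle E c \<longleftrightarrow>
     3 \<le> length c \<and> distinct c \<and> (\<forall>i<length c. {c ! i, c ! (Suc i mod length c)} \<in> E)"

text \<open>The chord joining positions \<open>i < j\<close> divides the cycle \<open>c\<close> into two paths, of
  lengths \<open>j - i\<close> and \<open>length c - (j - i)\<close>.\<close>

definition is_chord :: "'a set set \<Rightarrow> 'a list \<Rightarrow> nat \<Rightarrow> nat \<Rightarrow> bool" where
  "is_chord E c i j \<longleftrightarrow>
     i < j \<and> j < length c \<and> {c ! i, c ! j} \<in> E \<and>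
     j \<noteq> Suc i \<and> \<not> (i = 0 \<and> Suc j = length c)"

definition chordal :: "'a set set \<Rightarrow> bool" where
  "chordal E \<longleftrightarrow> (\<forall>c. is_cycle E c \<and> 3 < length c \<longrightarrow> (\<exists>i j. is_chord E c i j))"

definition strongly_chordal :: "'a set set \<Rightarrow> bool" where
  "strongly_chordal E \<longleftrightarrow>
     chordal E \<and>
     (\<forall>c. is_cycle E c \<and> even (length c) \<and> 6 \<le> length c \<longrightarrow>
        (\<exists>i j. is_chord E c i j \<and> odd (j - i) \<and> odd (length c - (j - i))))"

text \<open>Positions are counted from 0, so \<open>vs ! i\<close> is the vertex usually written
  \<open>v\<close> with index \<open>i + 1\<close>.\<close>

definition suffix_edges :: "'a set set \<Rightarrow> 'a list \<Rightarrow> nat \<Rightarrow> 'a set set" where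
  "suffix_edges E vs i = induced_edges E (set (drop i vs))"

definition strong_elimination_order :: "'a set \<Rightarrow> 'a set set \<Rightarrow> 'a list \<Rightarrow> bool" where
  "strong_elimination_order V E vs \<longleftrightarrow>
     distinct vs \<and> set vs = V \<and>
     (\<forall>i j k. i \<le> j \<and> j \<le> k \<and> k < length vs \<and>
        vs ! j \<in> closed_neighborhood (suffix_edges E vs i) (vs ! i) \<and>
        vs ! k \<in> closed_neighborhood (suffix_edges E vs i) (vs ! i) \<longrightarrow>
        closed_neighborhood (suffix_edges E vs i) (vs ! j)
          \<subseteq> closed_neighborhood (suffix_edges E vs i) (vs ! k))"

definition spanning_tree :: "'a set \<Rightarrow> 'a set set \<Rightarrow> 'a set set \<Rightarrow> bool" where
  "spanning_tree V E T \<longleftrightarrow> T \<subseteq> E \<and> connected_graph V T \<and> (\<nexists>c. is_cycle T c)"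

definition locally_connected_spanning_tree :: "'a set \<Rightarrow> 'a set set \<Rightarrow> 'a set set \<Rightarrow> bool" where
  "locally_connected_spanning_tree V E T \<longleftrightarrow>
     spanning_tree V E T \<and>
     (\<forall>v\<in>V. connected_graph (neighbors T v) (induced_edges E (neighbors T v)))"


section \<open>A random access machine\<close>

text \<open>
  Programs are while programs over registers and arrays of natural numbers. The instruction
  set is that of the usual random access machine with addition and (truncated) subtraction:
  a program mentions finitely many registers and arrays, so the arrays can be interleaved in
  one random access memory at the price of a constant factor.

  Every operation, including each register access, memory access and arithmetic operation
  inside an expression, costs at least one time unit. Unit cost is justified by a word bound:
  \<open>exec W\<close> gets stuck as soon as a value (in particular an address) greater than \<open>W\<close> is read
  or computed.
\<close>

record state =
  reg :: "string \<Rightarrow> nat"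
  arr :: "string \<Rightarrow> nat \<Rightarrow> nat"

datatype aexp = Const nat | Reg string | Load string aexp | Plus aexp aexp | Minus aexp aexp

datatype bexp = Less aexp aexp | Eq aexp aexp | Neg bexp | And bexp bexp

datatype com =
    Skip
  | Assign string aexp
  | Store string aexp aexp
  | Seq com com
  | Cond bexp com com
  | While bexp com

fun aval :: "aexp \<Rightarrow> state \<Rightarrow> nat" where
  "aval (Const k) s = k"
| "aval (Reg x) s = reg s x"
| "aval (Load a e) s = arr s a (aval e s)"
| "aval (Plus e1 e2) s = aval e1 s + aval e2 s"
| "aval (Minus e1 e2) s = aval e1 s - aval e2 s"

fun afits :: "nat \<Rightarrow> aexp \<Rightarrow> state \<Rightarrow> bool" where
  "afits W (Const k) s \<longleftrightarrow> k \<le> W"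
| "afits W (Reg x) s \<longleftrightarrow> reg s x \<le> W"
| "afits W (Load a e) s \<longleftrightarrow> afits W e s \<and> arr s a (aval e s) \<le> W"
| "afits W (Plus e1 e2) s \<longleftrightarrow> afits W e1 s \<and> afits W e2 s \<and> aval e1 s + aval e2 s \<le> W"
| "afits W (Minus e1 e2) s \<longleftrightarrow> afits W e1 s \<and> afits W e2 s"

fun acost :: "aexp \<Rightarrow> nat" where
  "acost (Const k) = 1"
| "acost (Reg x) = 1"
| "acost (Load a e) = acost e + 1"
| "acost (Plus e1 e2) = acost e1 + acost e2 + 1"
| "acost (Minus e1 e2) = acost e1 + acost e2 + 1"

fun bval :: "bexp \<Rightarrow> state \<Rightarrow> bool" where
  "bval (Less e1 e2) s \<longleftrightarrow> aval e1 s < aval e2 s"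
| "bval (Eq e1 e2) s \<longleftrightarrow> aval e1 s = aval e2 s"
| "bval (Neg b) s \<longleftrightarrow> \<not> bval b s"
| "bval (And b1 b2) s \<longleftrightarrow> bval b1 s \<and> bval b2 s"

fun bfits :: "nat \<Rightarrow> bexp \<Rightarrow> state \<Rightarrow> bool" where
  "bfits W (Less e1 e2) s \<longleftrightarrow> afits W e1 s \<and> afits W e2 s"
| "bfits W (Eq e1 e2) s \<longleftrightarrow> afits W e1 s \<and> afits W e2 s"
| "bfits W (Neg b) s \<longleftrightarrow> bfits W b s"
| "bfits W (And b1 b2) s \<longleftrightarrow> bfits W b1 s \<and> bfits W b2 s"

fun bcost :: "bexp \<Rightarrow> nat" where
  "bcost (Less e1 e2) = acost e1 + acost e2 + 1"
| "bcost (Eq e1 e2) = acost e1 + acost e2 + 1"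
| "bcost (Neg b) = bcost b + 1"
| "bcost (And b1 b2) = bcost b1 + bcost b2 + 1"

text \<open>\<open>exec W c s t s'\<close>: started in \<open>s\<close>, the program \<open>c\<close> halts in \<open>s'\<close> after \<open>t\<close> time units,
  and no value greater than \<open>W\<close> occurs.\<close>

inductive exec :: "nat \<Rightarrow> com \<Rightarrow> state \<Rightarrow> nat \<Rightarrow> state \<Rightarrow> bool" for W where
  Skip: "exec W Skip s 1 s"
| Assign: "afits W e s \<Longrightarrow>
    exec W (Assign x e) s (acost e + 1) (s\<lparr>reg := (reg s)(x := aval e s)\<rparr>)"
| Store: "afits W i s \<Longrightarrow> afits W e s \<Longrightarrow>
    exec W (Store a i e) s (acost i + acost e + 1)
      (s\<lparr>arr := (arr s)(a := (arr s a)(aval i s := aval e s))\<rparr>)"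
| Seq: "exec W c1 s t1 s1 \<Longrightarrow> exec W c2 s1 t2 s2 \<Longrightarrow> exec W (Seq c1 c2) s (t1 + t2) s2"
| CondTrue: "bfits W b s \<Longrightarrow> bval b s \<Longrightarrow> exec W c1 s t s1 \<Longrightarrow>
    exec W (Cond b c1 c2) s (bcost b + t) s1"
| CondFalse: "bfits W b s \<Longrightarrow> \<not> bval b s \<Longrightarrow> exec W c2 s t s1 \<Longrightarrow>
    exec W (Cond b c1 c2) s (bcost b + t) s1"
| WhileFalse: "bfits W b s \<Longrightarrow> \<not> bval b s \<Longrightarrow> exec W (While b c) s (bcost b) s"
| WhileTrue: "bfits W b s \<Longrightarrow> bval b s \<Longrightarrow> exec W c s t1 s1 \<Longrightarrow>
    exec W (While b c) s1 t2 s2 \<Longrightarrow> exec W (While b c) s (bcost b + t1 + t2) s2"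

inductive_cases SkipE: "exec W Skip s t s'"
inductive_cases AssignE: "exec W (Assign x e) s t s'"
inductive_cases StoreE: "exec W (Store a i e) s t s'"
inductive_cases SeqE: "exec W (Seq c1 c2) s t s'"
inductive_cases CondE: "exec W (Cond b c1 c2) s t s'"
inductive_cases WhileE: "exec W (While b c) s t s'"

lemma exec_deterministic:
  "exec W c s t s1 \<Longrightarrow> exec W c s t' s2 \<Longrightarrow> t' = t \<and> s2 = s1"
proof (induction arbitrary: t' s2 rule: exec.induct)
  case Skip
  then show ?case by (auto elim: SkipE)
next
  case Assign
  from Assign.prems show ?case by (auto elim: AssignE)
next
  case Store
  from Store.prems show ?case by (auto elim: StoreE)
next
  case Seq
  from Seq.prems show ?case by (rule SeqE) (use Seq.IH in blast)
next
  case CondTrue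
  from CondTrue.prems show ?case by (rule CondE) (use CondTrue in blast)+
next
  case CondFalse
  from CondFalse.prems show ?case by (rule CondE) (use CondFalse in blast)+
next
  case WhileFalse
  from WhileFalse.prems show ?case by (rule WhileE) (use WhileFalse in blast)+
next
  case WhileTrue
  from WhileTrue.prems show ?case by (rule WhileE) (use WhileTrue in blast)+
qed


section \<open>Input and output\<close>

text \<open>
  The vertices are the numbers below \<open>n\<close>. The graph is given by adjacency lists, in which the
  neighbors of a vertex are listed in an arbitrary order. The lists are stored one after the
  other in the array \<open>adj\<close>; the list of \<open>v\<close> occupies the positions from \<open>offset[v]\<close> up to, but
  not including, \<open>offset[v + 1]\<close>. All other cells are initially 0.
\<close>

definition adjacency_lists :: "nat \<Rightarrow> nat set set \<Rightarrow> nat list list \<Rightarrow> bool" where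
  "adjacency_lists n E adj \<longleftrightarrow>
     length adj = n \<and> (\<forall>v<n. distinct (adj ! v) \<and> set (adj ! v) = neighbors E v)"

definition array_of :: "nat list \<Rightarrow> nat \<Rightarrow> nat" where
  "array_of xs = (\<lambda>i. if i < length xs then xs ! i else 0)"

definition input_state :: "nat \<Rightarrow> nat \<Rightarrow> nat list list \<Rightarrow> nat list \<Rightarrow> state" where
  "input_state n m adj vs =
     \<lparr>reg = (\<lambda>_. 0)(''n'' := n, ''m'' := m),
      arr = (\<lambda>_ _. 0)
        (''offset'' := array_of (map (\<lambda>v. length (concat (take v adj))) [0..<Suc n]),
         ''adj'' := array_of (concat adj),
         ''order'' := array_of vs)\<rparr>"

definition output_edges :: "nat \<Rightarrow> state \<Rightarrow> nat set set" where
  "output_edges n s = {{arr s ''end1'' i, arr s ''end2'' i} | i. i < n - 1}"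

end

theory Submission
  imports Defs
begin

text \<open>
  A locally connected spanning tree exists iff every vertex but the last has a neighbor after it in
  the order and every vertex but the last two has at least two.

  Necessity: a graph with a locally connected spanning tree stays connected when a vertex \<open>x\<close> is
  deleted, because the tree neighbors of \<open>x\<close> are connected to each other without \<open>x\<close>. Deleting
  simplicial vertices preserves this property, so it holds in every suffix graph.

  Sufficiency: let \<open>g\<close> be the first vertex of the closed neighborhood of \<open>u\<close> whose last neighbor
  comes after \<open>u\<close>, and let the parent of \<open>u\<close> be the last neighbor of \<open>g\<close>. Nestedness of the
  neighborhoods at \<open>g\<close> shows that every earlier neighbor of \<open>u\<close> whose last neighbor comes after
  \<open>u\<close> is adjacent to the parent of \<open>u\<close>. Hence a child \<open>v\<close> of \<open>x\<close> is adjacent to a later tree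
  neighbor of \<open>x\<close>: to the parent of \<open>x\<close> if \<open>x\<close> is not the last neighbor of \<open>v\<close>, and otherwise
  to the second last neighbor of \<open>v\<close>, whose parent is \<open>x\<close>.
\<close>

section \<open>Connectedness\<close>

definition adjacency :: "'a set set \<Rightarrow> 'a rel" where
  "adjacency E = {(u, v). {u, v} \<in> E}"

abbreviation connected_on :: "'a set set \<Rightarrow> 'a set \<Rightarrow> bool" where
  "connected_on E S \<equiv> connected_graph S (induced_edges E S)"

definition simplicial :: "'a set set \<Rightarrow> 'a set \<Rightarrow> 'a \<Rightarrow> bool" where
  "simplicial E S v \<longleftrightarrow>
     (\<forall>a\<in>S. \<forall>b\<in>S. {v, a} \<in> E \<longrightarrow> {v, b} \<in> E \<longrightarrow> a \<noteq> b \<longrightarrow> {a, b} \<in> E)"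

lemma in_adjacency_iff [simp]: "(u, v) \<in> adjacency E \<longleftrightarrow> {u, v} \<in> E"
  by (simp add: adjacency_def)

lemma in_induced_edges_iff: "{u, v} \<in> induced_edges E S \<longleftrightarrow> {u, v} \<in> E \<and> u \<in> S \<and> v \<in> S"
  by (simp add: induced_edges_def)

lemma rtrancl_adjacency_mono:
  "(u, v) \<in> (adjacency E)\<^sup>* \<Longrightarrow> E \<subseteq> F \<Longrightarrow> (u, v) \<in> (adjacency F)\<^sup>*"
  by (rule rtrancl_mono[THEN subsetD]) auto

lemma sym_rtrancl_adjacency: "sym ((adjacency E)\<^sup>*)"
  by (rule sym_rtrancl) (simp add: sym_def insert_commute)

lemma connected_graph_rtrancl:
  "connected_graph V E \<Longrightarrow> u \<in> V \<Longrightarrow> v \<in> V \<Longrightarrow> (u, v) \<in> (adjacency E)\<^sup>*"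
  by (simp add: connected_graph_def adjacency_def)

lemma connected_graphI:
  assumes "r \<in> V" "\<And>v. v \<in> V \<Longrightarrow> (v, r) \<in> (adjacency E)\<^sup>*"
  shows "connected_graph V E"
proof -
  have "(u, v) \<in> (adjacency E)\<^sup>*" if "u \<in> V" "v \<in> V" for u v
    using assms(2)[OF that(1)] symD[OF sym_rtrancl_adjacency assms(2)[OF that(2)]]
    by (rule rtrancl_trans)
  then show ?thesis using assms(1) by (auto simp: connected_graph_def adjacency_def)
qed

lemma connected_graph_if_ascending:
  fixes h :: "'a \<Rightarrow> 'b :: linorder"
  assumes "finite V" "r \<in> V"
    and ascent: "\<And>v. v \<in> V \<Longrightarrow> v \<noteq> r \<Longrightarrow> \<exists>z\<in>V. {v, z} \<in> E \<and> h v < h z"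
  shows "connected_graph V E"
proof (rule connected_graphI[OF \<open>r \<in> V\<close>])
  fix v assume "v \<in> V"
  then show "(v, r) \<in> (adjacency E)\<^sup>*"
  proof (induction "card {w \<in> V. h v < h w}" arbitrary: v rule: less_induct)
    case less
    show ?case
    proof (cases "v = r")
      case False
      then obtain z where z: "z \<in> V" "{v, z} \<in> E" "h v < h z"
        using ascent less.prems by blast
      then have "{w \<in> V. h z < h w} \<subset> {w \<in> V. h v < h w}" by auto
      then have "card {w \<in> V. h z < h w} < card {w \<in> V. h v < h w}"
        using assms(1) by (intro psubset_card_mono) auto
      then have "(z, r) \<in> (adjacency E)\<^sup>*" using less.hyps z(1) by blast
      then show ?thesis using z(2) by (auto intro: converse_rtrancl_into_rtrancl)
    qed simp
  qed
qed

text \<open>Contracting \<open>v\<close> onto one of its neighbors maps walks in \<open>S\<close> to walks that avoid \<open>v\<close>.\<close>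

lemma connected_on_delete_simplicial:
  assumes con: "connected_on E S" and simp: "simplicial E S v" and "S \<noteq> {v}"
  shows "connected_on E (S - {v})"
proof -
  let ?S = "S - {v}"
  define contract where "contract = id(v := SOME y. y \<in> ?S \<and> {v, y} \<in> E)"
  have contract_v: "contract v \<in> ?S \<and> {v, contract v} \<in> E" if "b \<in> ?S" "{v, b} \<in> E" for b
    unfolding contract_def fun_upd_same by (rule someI) (use that in blast)
  have contract_other: "contract a = a" if "a \<noteq> v" for a using that by (simp add: contract_def)
  have edge: "(contract a, contract b) \<in> (adjacency (induced_edges E ?S))\<^sup>="
    if "(a, b) \<in> adjacency (induced_edges E S)" for a b
  proof -
    have ab: "{a, b} \<in> E" "{b, a} \<in> E" "a \<in> S" "b \<in> S"
      using that by (auto simp: induced_edges_def insert_commute)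
    consider "a = v" "b = v" | "a = v" "b \<noteq> v" | "a \<noteq> v" "b = v" | "a \<noteq> v" "b \<noteq> v" by blast
    then show ?thesis
    proof cases
      case 2
      then show ?thesis using contract_v[of b] ab simp
        by (auto simp: contract_other simplicial_def induced_edges_def)
    next
      case 3
      then show ?thesis using contract_v[of a] ab simp
        by (auto simp: contract_other simplicial_def induced_edges_def)
    qed (use ab in \<open>auto simp: contract_other induced_edges_def\<close>)
  qed
  have walk: "(contract a, contract b) \<in> (adjacency (induced_edges E ?S))\<^sup>*"
    if "(a, b) \<in> (adjacency (induced_edges E S))\<^sup>*" for a b
    using that
  proof (induction rule: rtrancl_induct)
    case (step b c)
    then show ?case using edge[of b c] by (auto intro: rtrancl_into_rtrancl)
  qed simp
  have "(a, b) \<in> (adjacency (induced_edges E ?S))\<^sup>*" if "a \<in> ?S" "b \<in> ?S" for a b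
    using walk[OF connected_graph_rtrancl[OF con, of a b]] that by (simp add: contract_other)
  moreover have "?S \<noteq> {}" using con \<open>S \<noteq> {v}\<close> by (auto simp: connected_graph_def)
  ultimately show ?thesis by (meson connected_graphI ex_in_conv)
qed

section \<open>Graphs with a locally connected spanning tree\<close>

lemma in_neighbors_iff: "u \<in> neighbors E v \<longleftrightarrow> {v, u} \<in> E"
  by (simp add: neighbors_def insert_commute)

lemma in_closed_neighborhood_iff: "u \<in> closed_neighborhood E v \<longleftrightarrow> u = v \<or> {v, u} \<in> E"
  by (simp add: closed_neighborhood_def in_neighbors_iff)

lemma simple_graph_edgeD:
  assumes "simple_graph V E" "{u, v} \<in> E"
  shows "u \<in> V" "v \<in> V" "u \<noteq> v"
  using assms by (auto simp: simple_graph_def)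

lemma walk_to_neighbor_avoiding:
  assumes "(u, x) \<in> (adjacency T)\<^sup>*" "u \<noteq> x"
  shows "\<exists>y\<in>neighbors T x. (u, y) \<in> (adjacency (induced_edges T (- {x})))\<^sup>*"
  using assms
proof (induction rule: converse_rtrancl_induct)
  case (step u z)
  show ?case
  proof (cases "z = x")
    case True
    then show ?thesis using step.hyps(1) by (auto simp: neighbors_def)
  next
    case False
    then obtain y where "y \<in> neighbors T x" "(z, y) \<in> (adjacency (induced_edges T (- {x})))\<^sup>*"
      using step.IH by blast
    moreover have "(u, z) \<in> adjacency (induced_edges T (- {x}))"
      using step.hyps(1) step.prems False by (simp add: induced_edges_def)
    ultimately show ?thesis by (meson converse_rtrancl_into_rtrancl)
  qed
qed simp

lemma lcst_imp_connected_on_delete: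
  assumes graph: "simple_graph V E" and lcst: "locally_connected_spanning_tree V E T"
    and "x \<in> V"
  shows "connected_on E (V - {x})"
proof -
  let ?R = "adjacency (induced_edges E (V - {x}))"
  have TE: "T \<subseteq> E" and tree: "connected_graph V T" and loc: "connected_on E (neighbors T x)"
    using lcst \<open>x \<in> V\<close> by (auto simp: locally_connected_spanning_tree_def spanning_tree_def)
  have nbrs: "neighbors T x \<subseteq> V - {x}"
    using TE simple_graph_edgeD[OF graph] unfolding neighbors_def by blast
  obtain r where r: "r \<in> neighbors T x" using loc by (auto simp: connected_graph_def)
  show ?thesis
  proof (rule connected_graphI)
    fix v assume v: "v \<in> V - {x}"
    obtain y where y: "y \<in> neighbors T x" "(v, y) \<in> (adjacency (induced_edges T (- {x})))\<^sup>*"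
      using walk_to_neighbor_avoiding[OF connected_graph_rtrancl[OF tree]] v \<open>x \<in> V\<close> by blast
    have "(v, y) \<in> ?R\<^sup>*"
      using y(2)
      by (rule rtrancl_adjacency_mono)
        (use TE graph in \<open>auto simp: induced_edges_def simple_graph_def\<close>)
    also have "(y, r) \<in> ?R\<^sup>*"
      using connected_graph_rtrancl[OF loc y(1) r]
      by (rule rtrancl_adjacency_mono) (use nbrs in \<open>auto simp: induced_edges_def\<close>)
    finally show "(v, r) \<in> ?R\<^sup>*" .
  qed (use r nbrs in blast)
qed

section \<open>Trees given by parents\<close>

definition parent_edges :: "'a set \<Rightarrow> 'a \<Rightarrow> ('a \<Rightarrow> 'a) \<Rightarrow> 'a set set" where
  "parent_edges V r p = {{v, p v} | v. v \<in> V - {r}}"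

lemma in_parent_edges_iff:
  fixes h :: "'a \<Rightarrow> 'b :: linorder"
  assumes "\<And>v. v \<in> V - {r} \<Longrightarrow> h v < h (p v)" "h x \<le> h y"
  shows "{x, y} \<in> parent_edges V r p \<longleftrightarrow> x \<in> V - {r} \<and> y = p x"
proof
  assume "{x, y} \<in> parent_edges V r p"
  then obtain v where "v \<in> V - {r}" "{x, y} = {v, p v}" by (auto simp: parent_edges_def)
  moreover from this(1) have "h v < h (p v)" by (rule assms(1))
  ultimately show "x \<in> V - {r} \<and> y = p x" using assms(2) by (auto simp: doubleton_eq_iff)
qed (auto simp: parent_edges_def)

lemma parent_edges_acyclic:
  fixes h :: "'a \<Rightarrow> 'b :: linorder"
  assumes ascent: "\<And>v. v \<in> V - {r} \<Longrightarrow> h v < h (p v)"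
  shows "\<not> is_cycle (parent_edges V r p) c"
proof
  assume "is_cycle (parent_edges V r p) c"
  then have len: "3 \<le> length c" and "distinct c"
    and edge: "\<And>i. i < length c \<Longrightarrow> {c ! i, c ! (Suc i mod length c)} \<in> parent_edges V r p"
    by (auto simp: is_cycle_def)
  have "{..<length c} \<noteq> {}" using len by (auto simp: lessThan_empty_iff)
  then obtain k where k: "k < length c" and "h (c ! k) = Min ((\<lambda>i. h (c ! i)) ` {..<length c})"
    by (metis (no_types, lifting) finite_lessThan lessThan_iff obtains_MIN)
  then have least: "h (c ! k) \<le> h (c ! i)" if "i < length c" for i using that by simp
  define pred where "pred = (if k = 0 then length c - 1 else k - 1)"
  have pred: "pred < length c" "Suc pred mod length c = k" using k len by (auto simp: pred_def)
  have succ: "Suc k mod length c < length c" using k by (intro mod_less_divisor) linarith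
  have "c ! (Suc k mod length c) = p (c ! k)"
    using in_parent_edges_iff[where h = h, OF ascent least[OF succ]] edge[OF k] by simp
  moreover have "c ! pred = p (c ! k)"
    using in_parent_edges_iff[where h = h, OF ascent least[OF pred(1)]] edge[OF pred(1)] pred(2)
    by (simp add: insert_commute)
  ultimately have "Suc k mod length c = pred"
    using nth_eq_iff_index_eq[OF \<open>distinct c\<close> succ pred(1)] by simp
  then show False using k len by (cases "Suc k = length c") (auto simp: pred_def split: if_splits)
qed

lemma spanning_tree_parent_edges:
  fixes h :: "'a \<Rightarrow> 'b :: linorder"
  assumes "finite V" "r \<in> V"
    and parent: "\<And>v. v \<in> V - {r} \<Longrightarrow> {v, p v} \<in> E \<and> p v \<in> V \<and> h v < h (p v)"
  shows "spanning_tree V E (parent_edges V r p)"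
  unfolding spanning_tree_def
proof (intro conjI)
  show "parent_edges V r p \<subseteq> E" using parent by (auto simp: parent_edges_def)
  show "connected_graph V (parent_edges V r p)"
    by (rule connected_graph_if_ascending[OF assms(1,2), where h = h])
      (use parent in \<open>auto simp: parent_edges_def\<close>)
  show "\<nexists>c. is_cycle (parent_edges V r p) c" using parent_edges_acyclic[where h = h] parent by blast
qed

section \<open>Strong elimination orders\<close>

locale strong_elimination =
  fixes V :: "'a set" and E :: "'a set set" and vs :: "'a list"
  assumes graph: "simple_graph V E"
    and order: "strong_elimination_order V E vs"
begin

definition pos :: "'a \<Rightarrow> nat" where
  "pos = inv_into {..<length vs} ((!) vs)"

definition first :: "'a set \<Rightarrow> 'a" where
  "first S = vs ! Min (pos ` S)"

definition latest :: "'a set \<Rightarrow> 'a" where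
  "latest S = vs ! Max (pos ` S)"

definition last_neighbor :: "'a \<Rightarrow> 'a" where
  "last_neighbor v = latest (closed_neighborhood E v)"

definition higher_neighbors :: "'a \<Rightarrow> 'a set" where
  "higher_neighbors v = {u \<in> neighbors E v. pos v < pos u}"

definition guides :: "'a \<Rightarrow> 'a set" where
  "guides u = insert u {w \<in> neighbors E u. pos u < pos (last_neighbor w)}"

definition parent :: "'a \<Rightarrow> 'a" where
  "parent u = last_neighbor (first (guides u))"

definition parent_tree :: "'a set set" where
  "parent_tree = parent_edges V (last vs) parent"

text \<open>Only the last vertex may lack a higher neighbor, and only the last two may have fewer than
  two.\<close>

definition enough_higher_neighbors :: bool where
  "enough_higher_neighbors \<longleftrightarrow>
     (\<forall>v\<in>V. min 2 (length vs - Suc (pos v)) \<le> card (higher_neighbors v))"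

lemma distinct_vs: "distinct vs" and set_vs: "set vs = V"
  using order by (auto simp: strong_elimination_order_def)

lemma length_vs: "length vs = card V"
  using distinct_card[OF distinct_vs] set_vs by simp

lemma finite_V: "finite V"
  using graph by (simp add: simple_graph_def)

lemmas edgeD = simple_graph_edgeD[OF graph]

lemma pos_nth: "i < length vs \<Longrightarrow> pos (vs ! i) = i"
  unfolding pos_def by (rule inv_into_f_f) (simp_all add: inj_on_nth distinct_vs)

lemma nth_pos: "v \<in> V \<Longrightarrow> vs ! pos v = v" and pos_less: "v \<in> V \<Longrightarrow> pos v < length vs"
  unfolding set_vs[symmetric] by (auto simp: in_set_conv_nth pos_nth)

lemma nth_in_V: "i < length vs \<Longrightarrow> vs ! i \<in> V"
  using set_vs by auto

lemma pos_eq_iff: "u \<in> V \<Longrightarrow> v \<in> V \<Longrightarrow> pos u = pos v \<longleftrightarrow> u = v"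
  by (metis nth_pos)

lemma set_drop_vs: "set (drop i vs) = {v \<in> V. i \<le> pos v}"
proof (intro set_eqI iffI)
  fix v assume "v \<in> set (drop i vs)"
  then obtain k where "k < length vs - i" "v = vs ! (i + k)"
    by (auto simp: in_set_conv_nth)
  then show "v \<in> {v \<in> V. i \<le> pos v}" by (simp add: pos_nth nth_in_V)
next
  fix v assume v: "v \<in> {v \<in> V. i \<le> pos v}"
  then have "v = drop i vs ! (pos v - i)" "pos v - i < length (drop i vs)"
    using nth_pos[of v] pos_less[of v] by auto
  then show "v \<in> set (drop i vs)" by (metis nth_mem)
qed

lemma last_vs:
  assumes "V \<noteq> {}"
  shows "last vs \<in> V" "pos (last vs) = length vs - 1"
proof -
  have "vs \<noteq> []" using assms set_vs by auto
  then show "last vs \<in> V" "pos (last vs) = length vs - 1"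
    using set_vs by (auto simp: last_conv_nth pos_nth)
qed

lemma neq_last_iff: "v \<in> V \<Longrightarrow> v \<noteq> last vs \<longleftrightarrow> Suc (pos v) < length vs"
  using pos_eq_iff[of v "last vs"] last_vs pos_less[of v] by fastforce

lemma nth_in_if_in_pos_image:
  "S \<subseteq> V \<Longrightarrow> k \<in> pos ` S \<Longrightarrow> vs ! k \<in> S \<and> pos (vs ! k) = k"
  using nth_pos by auto

lemma first_in: "S \<subseteq> V \<Longrightarrow> S \<noteq> {} \<Longrightarrow> first S \<in> S"
  and pos_first: "S \<subseteq> V \<Longrightarrow> S \<noteq> {} \<Longrightarrow> pos (first S) = Min (pos ` S)"
  unfolding first_def using nth_in_if_in_pos_image[of S "Min (pos ` S)"]
  by (simp_all add: finite_subset[OF _ finite_V])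

lemma latest_in: "S \<subseteq> V \<Longrightarrow> S \<noteq> {} \<Longrightarrow> latest S \<in> S"
  and pos_latest: "S \<subseteq> V \<Longrightarrow> S \<noteq> {} \<Longrightarrow> pos (latest S) = Max (pos ` S)"
  unfolding latest_def using nth_in_if_in_pos_image[of S "Max (pos ` S)"]
  by (simp_all add: finite_subset[OF _ finite_V])

lemma pos_first_le: "S \<subseteq> V \<Longrightarrow> v \<in> S \<Longrightarrow> pos (first S) \<le> pos v"
  by (subst pos_first) (auto intro!: Min_le intro: finite_subset[OF _ finite_V])

lemma pos_le_latest: "S \<subseteq> V \<Longrightarrow> v \<in> S \<Longrightarrow> pos v \<le> pos (latest S)"
  by (subst pos_latest) (auto intro!: Max_ge intro: finite_subset[OF _ finite_V])

lemma neighbors_subset: "neighbors E v \<subseteq> V"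
  using edgeD by (auto simp: neighbors_def)

lemma closed_neighborhood_subset: "v \<in> V \<Longrightarrow> closed_neighborhood E v \<subseteq> V"
  using neighbors_subset by (simp add: closed_neighborhood_def)

lemma in_suffix_closed_neighborhood_iff:
  assumes "v \<in> V" "i \<le> pos v"
  shows "u \<in> closed_neighborhood (suffix_edges E vs i) v \<longleftrightarrow>
    u \<in> closed_neighborhood E v \<and> i \<le> pos u"
  using assms edgeD
  by (auto simp: in_closed_neighborhood_iff suffix_edges_def induced_edges_def set_drop_vs)

lemma closed_neighborhoods_nested:
  assumes "v \<in> V" and a: "a \<in> closed_neighborhood E v" and b: "b \<in> closed_neighborhood E v"
    and le: "pos v \<le> pos a" "pos a \<le> pos b"
    and w: "w \<in> closed_neighborhood E a" "pos v \<le> pos w"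
  shows "w \<in> closed_neighborhood E b"
proof -
  have V: "a \<in> V" "b \<in> V" using closed_neighborhood_subset assms by blast+
  let ?G = "suffix_edges E vs (pos v)"
  have "closed_neighborhood ?G (vs ! pos a) \<subseteq> closed_neighborhood ?G (vs ! pos b)"
    by (rule order[unfolded strong_elimination_order_def, THEN conjunct2, THEN conjunct2,
          rule_format])
      (use assms V in \<open>simp add: nth_pos pos_less in_suffix_closed_neighborhood_iff\<close>)
  then show ?thesis
    using w le V by (auto simp: nth_pos in_suffix_closed_neighborhood_iff)
qed

lemma higher_neighbors_adjacent:
  assumes "a \<in> higher_neighbors v" "b \<in> higher_neighbors v" "a \<noteq> b"
  shows "{a, b} \<in> E"
proof -
  have "{a, b} \<in> E"
    if ab: "a \<in> higher_neighbors v" "b \<in> higher_neighbors v" "a \<noteq> b" and "pos a \<le> pos b" for a b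
  proof -
    have "v \<in> V" using ab edgeD by (auto simp: higher_neighbors_def in_neighbors_iff)
    then have "a \<in> closed_neighborhood E b"
      using that closed_neighborhoods_nested[of v a b a]
      by (auto simp: higher_neighbors_def in_neighbors_iff in_closed_neighborhood_iff)
    then show ?thesis using ab by (simp add: in_closed_neighborhood_iff insert_commute)
  qed
  from this[of a b] this[of b a] show ?thesis
    using assms by (cases "pos a \<le> pos b") (simp_all add: insert_commute)
qed

lemma last_neighbor_in: "v \<in> V \<Longrightarrow> last_neighbor v \<in> closed_neighborhood E v"
  unfolding last_neighbor_def
  by (intro latest_in closed_neighborhood_subset) (simp_all add: closed_neighborhood_def)

lemma last_neighbor_in_V: "v \<in> V \<Longrightarrow> last_neighbor v \<in> V"
  using last_neighbor_in closed_neighborhood_subset by blast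

lemma pos_le_last_neighbor:
  "v \<in> V \<Longrightarrow> u \<in> closed_neighborhood E v \<Longrightarrow> pos u \<le> pos (last_neighbor v)"
  unfolding last_neighbor_def by (intro pos_le_latest closed_neighborhood_subset)

lemma guides_subset: "u \<in> V \<Longrightarrow> guides u \<subseteq> V"
  using neighbors_subset by (auto simp: guides_def)

lemma first_guide_in: "u \<in> V \<Longrightarrow> first (guides u) \<in> guides u"
  by (intro first_in guides_subset) (simp_all add: guides_def)

lemma pos_first_guide_le: "u \<in> V \<Longrightarrow> w \<in> guides u \<Longrightarrow> pos (first (guides u)) \<le> pos w"
  by (intro pos_first_le guides_subset)

lemma first_guide_in_V: "u \<in> V \<Longrightarrow> first (guides u) \<in> V"
  using first_guide_in guides_subset by blast

lemma
  assumes u: "u \<in> V" "pos u < pos (last_neighbor u)"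
  shows parent_in_V: "parent u \<in> V"
    and pos_less_parent: "pos u < pos (parent u)"
    and in_closed_neighborhood_parent: "w \<in> closed_neighborhood E u \<Longrightarrow>
      pos (first (guides u)) \<le> pos w \<Longrightarrow> w \<in> closed_neighborhood E (parent u)"
proof -
  define g where "g = first (guides u)"
  have g: "g \<in> V" "g \<in> guides u" using first_guide_in first_guide_in_V u(1) by (auto simp: g_def)
  have parent: "parent u = last_neighbor g" by (simp add: parent_def g_def)
  then show "parent u \<in> V" using last_neighbor_in_V g(1) by simp
  show less: "pos u < pos (parent u)" using g(2) u(2) by (auto simp: guides_def parent)
  have "u \<in> closed_neighborhood E g"
    using g(2) by (auto simp: guides_def in_closed_neighborhood_iff in_neighbors_iff insert_commute)
  moreover have "pos g \<le> pos u"
    unfolding g_def by (intro pos_first_guide_le u(1)) (simp add: guides_def)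
  ultimately show "w \<in> closed_neighborhood E (parent u)"
    if "w \<in> closed_neighborhood E u" "pos (first (guides u)) \<le> pos w"
    using closed_neighborhoods_nested[of g u "parent u" w] that g(1) less last_neighbor_in[OF g(1)]
    by (simp add: parent flip: g_def)
qed

lemma parent_adjacent:
  assumes "u \<in> V" "pos u < pos (last_neighbor u)"
  shows "{u, parent u} \<in> E"
proof -
  have "pos (first (guides u)) \<le> pos u"
    by (intro pos_first_guide_le assms(1)) (simp add: guides_def)
  then have "u \<in> closed_neighborhood E (parent u)"
    using in_closed_neighborhood_parent[OF assms, of u] by (simp add: in_closed_neighborhood_iff)
  then show ?thesis
    using pos_less_parent[OF assms] by (auto simp: in_closed_neighborhood_iff insert_commute)
qed

lemma parent_in_higher_neighbors:
  assumes "u \<in> higher_neighbors w" "pos u < pos (last_neighbor w)"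
    and u: "u \<in> V" "pos u < pos (last_neighbor u)"
  shows "parent u \<in> higher_neighbors w"
proof -
  have "w \<in> neighbors E u"
    using assms(1) by (auto simp: higher_neighbors_def in_neighbors_iff insert_commute)
  then have "pos (first (guides u)) \<le> pos w"
    using assms(2) by (intro pos_first_guide_le u) (simp add: guides_def)
  then have "w \<in> closed_neighborhood E (parent u)"
    using \<open>w \<in> neighbors E u\<close>
    by (intro in_closed_neighborhood_parent u) (simp_all add: closed_neighborhood_def)
  moreover have "pos w < pos (parent u)"
    using assms(1) pos_less_parent[OF u] by (simp add: higher_neighbors_def)
  ultimately show ?thesis
    by (auto simp: higher_neighbors_def in_closed_neighborhood_iff in_neighbors_iff insert_commute)
qed

lemma parent_tree_eq_nth:
  "parent_tree = {{vs ! i, parent (vs ! i)} | i. i < length vs - 1}"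
proof -
  have "V - {last vs} = (!) vs ` {..<length vs - 1}"
  proof (intro equalityI subsetI)
    fix v assume v: "v \<in> V - {last vs}"
    then show "v \<in> (!) vs ` {..<length vs - 1}"
      using neq_last_iff[of v] nth_pos[of v] by (intro image_eqI[of _ _ "pos v"]) auto
  next
    fix v assume "v \<in> (!) vs ` {..<length vs - 1}"
    then obtain i where "v = vs ! i" "i < length vs - 1" by blast
    then show "v \<in> V - {last vs}" using neq_last_iff[of v] nth_in_V[of i] pos_nth[of i] by auto
  qed
  then show ?thesis by (auto simp: parent_tree_def parent_edges_def)
qed

lemma enough_higher_neighbors_iff_nth:
  "enough_higher_neighbors \<longleftrightarrow>
     (\<forall>i<length vs - 1. min 2 (length vs - Suc i) \<le> card (higher_neighbors (vs ! i)))"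
proof
  assume enough: enough_higher_neighbors
  show "\<forall>i<length vs - 1. min 2 (length vs - Suc i) \<le> card (higher_neighbors (vs ! i))"
  proof (intro allI impI)
    fix i assume "i < length vs - 1"
    then have "vs ! i \<in> V" "pos (vs ! i) = i" by (simp_all add: nth_in_V pos_nth)
    then show "min 2 (length vs - Suc i) \<le> card (higher_neighbors (vs ! i))"
      using enough unfolding enough_higher_neighbors_def by metis
  qed
next
  assume nth: "\<forall>i<length vs - 1. min 2 (length vs - Suc i) \<le> card (higher_neighbors (vs ! i))"
  show enough_higher_neighbors
    unfolding enough_higher_neighbors_def
  proof
    fix v assume "v \<in> V"
    then show "min 2 (length vs - Suc (pos v)) \<le> card (higher_neighbors v)"
      using nth[rule_format, of "pos v"] by (cases "pos v < length vs - 1") (simp_all add: nth_pos)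
  qed
qed

subsection \<open>Sufficiency\<close>

context
  assumes enough: enough_higher_neighbors and two_le_length: "2 \<le> length vs"
begin

lemma higher_neighbors_nonempty:
  assumes "v \<in> V - {last vs}"
  shows "higher_neighbors v \<noteq> {}"
proof -
  have "1 \<le> min 2 (length vs - Suc (pos v))" using assms neq_last_iff[of v] by simp
  then have "1 \<le> card (higher_neighbors v)"
    using enough assms unfolding enough_higher_neighbors_def by fastforce
  then show ?thesis by auto
qed

lemma pos_less_last_neighbor:
  assumes "v \<in> V - {last vs}"
  shows "pos v < pos (last_neighbor v)"
proof -
  obtain u where "u \<in> neighbors E v" "pos v < pos u"
    using higher_neighbors_nonempty[OF assms] by (auto simp: higher_neighbors_def)
  then show ?thesis
    using pos_le_last_neighbor[of v u] assms by (simp add: closed_neighborhood_def)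
qed

lemma parent_adjacent_later:
  assumes "v \<in> V - {last vs}"
  shows "{v, parent v} \<in> E \<and> parent v \<in> V \<and> pos v < pos (parent v)"
  using pos_less_last_neighbor[OF assms] parent_adjacent parent_in_V pos_less_parent assms by blast

lemma last_in_V: "last vs \<in> V" and pos_last: "pos (last vs) = length vs - 1"
  using last_vs two_le_length set_vs by fastforce+

lemma in_parent_tree_iff:
  "pos x \<le> pos y \<Longrightarrow> {x, y} \<in> parent_tree \<longleftrightarrow> x \<in> V - {last vs} \<and> y = parent x"
  unfolding parent_tree_def
  by (rule in_parent_edges_iff[where h = pos]) (use parent_adjacent_later in auto)

lemma spanning_tree_parent_tree: "spanning_tree V E parent_tree"
  unfolding parent_tree_def
  by (rule spanning_tree_parent_edges[where h = pos, OF finite_V last_in_V parent_adjacent_later])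

lemma parent_in_tree_neighbors: "v \<in> V - {last vs} \<Longrightarrow> parent v \<in> neighbors parent_tree v"
  and child_in_tree_neighbors: "v \<in> V - {last vs} \<Longrightarrow> v \<in> neighbors parent_tree (parent v)"
  by (auto simp: neighbors_def parent_tree_def parent_edges_def insert_commute)

lemma
  assumes "v \<in> V" "u \<in> higher_neighbors v" "u \<noteq> last_neighbor v"
  shows higher_neighbor_not_last: "u \<in> V - {last vs}"
    and parent_of_higher_neighbor: "parent u \<in> higher_neighbors v"
proof -
  have u: "u \<in> V" "u \<in> closed_neighborhood E v"
    using assms(2) neighbors_subset by (auto simp: higher_neighbors_def closed_neighborhood_def)
  then have less: "pos u < pos (last_neighbor v)"
    using pos_le_last_neighbor[OF assms(1) u(2)] assms last_neighbor_in_V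
    by (simp add: le_less pos_eq_iff)
  then show not_last: "u \<in> V - {last vs}"
    using u(1) pos_less[OF last_neighbor_in_V[OF assms(1)]] neq_last_iff[OF u(1)] by simp
  show "parent u \<in> higher_neighbors v"
    by (rule parent_in_higher_neighbors[OF assms(2) less u(1) pos_less_last_neighbor[OF not_last]])
qed

lemma child_adjacent_later_tree_neighbor:
  assumes v: "v \<in> V" "pos v + 2 < length vs"
  shows "\<exists>z\<in>neighbors parent_tree (parent v). {v, z} \<in> E \<and> pos v < pos z"
proof -
  have "v \<in> V - {last vs}" using v neq_last_iff by simp
  note parent = parent_adjacent_later[OF this]
  show ?thesis
  proof (cases "parent v = last_neighbor v")
    case False
    have "parent v \<in> higher_neighbors v"
      using parent by (simp add: higher_neighbors_def in_neighbors_iff)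
    then have "parent v \<in> V - {last vs}" "parent (parent v) \<in> higher_neighbors v"
      using higher_neighbor_not_last parent_of_higher_neighbor v(1) False by blast+
    then show ?thesis
      using parent_in_tree_neighbors by (auto simp: higher_neighbors_def in_neighbors_iff)
  next
    case True
    define S where "S = higher_neighbors v - {last_neighbor v}"
    have "2 \<le> card (higher_neighbors v)"
      using enough v unfolding enough_higher_neighbors_def by fastforce
    then have "\<not> higher_neighbors v \<subseteq> {last_neighbor v}"
      by (auto dest: card_mono[rotated])
    then have S: "S \<subseteq> V" "S \<noteq> {}"
      using neighbors_subset by (auto simp: S_def higher_neighbors_def)
    define z where "z = latest S"
    have z: "z \<in> higher_neighbors v" "z \<noteq> last_neighbor v"
      using latest_in[OF S] by (auto simp: z_def S_def)
    note not_last = higher_neighbor_not_last[OF v(1) z]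
    have "parent z \<notin> S"
      using pos_le_latest[OF S(1)] parent_adjacent_later[OF not_last] by (fastforce simp: z_def)
    then have "parent z = parent v"
      using parent_of_higher_neighbor[OF v(1) z] True by (simp add: S_def)
    then have "z \<in> neighbors parent_tree (parent v)"
      using child_in_tree_neighbors[OF not_last] by simp
    then show ?thesis using z(1) by (auto simp: higher_neighbors_def in_neighbors_iff)
  qed
qed

lemma second_last_in_tree_neighbors_last:
  "vs ! (length vs - 2) \<in> neighbors parent_tree (last vs)"
proof -
  let ?y = "vs ! (length vs - 2)"
  have pos_y: "pos ?y = length vs - 2" using two_le_length by (intro pos_nth) linarith
  have "?y \<in> V" using two_le_length by (intro nth_in_V) linarith
  then have y: "?y \<in> V - {last vs}" using neq_last_iff[of ?y] pos_y two_le_length by simp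
  note parent = parent_adjacent_later[OF y]
  have "pos (parent ?y) = pos (last vs)"
    using parent pos_less[of "parent ?y"] unfolding pos_y pos_last by linarith
  then have "parent ?y = last vs" using parent last_in_V by (simp add: pos_eq_iff)
  then show ?thesis using child_in_tree_neighbors[OF y] by simp
qed

lemma parent_tree_locally_connected:
  assumes x: "x \<in> V"
  shows "connected_on E (neighbors parent_tree x)"
proof (rule connected_graph_if_ascending)
  let ?r = "if x = last vs then vs ! (length vs - 2) else parent x"
  have subset: "neighbors parent_tree x \<subseteq> V"
    using spanning_tree_parent_tree edgeD by (auto simp: spanning_tree_def neighbors_def)
  then show "finite (neighbors parent_tree x)" using finite_V by (rule finite_subset)
  show "?r \<in> neighbors parent_tree x"
    using x parent_in_tree_neighbors second_last_in_tree_neighbors_last by simp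
  fix y assume y: "y \<in> neighbors parent_tree x" and "y \<noteq> ?r"
  have "\<not> pos x \<le> pos y"
    using in_parent_tree_iff[of x y] y \<open>y \<noteq> ?r\<close> by (auto simp: in_neighbors_iff)
  then have less: "pos y < pos x" by simp
  then have "y \<in> V" "x = parent y"
    using in_parent_tree_iff[of y x] y by (auto simp: neighbors_def)
  have "pos y + 2 < length vs"
  proof (rule ccontr)
    assume "\<not> pos y + 2 < length vs"
    then have "pos y = length vs - 2" "pos x = pos (last vs)"
      using less pos_less[OF x] unfolding pos_last by linarith+
    then have "y = ?r" using nth_pos[OF \<open>y \<in> V\<close>] x last_in_V by (simp add: pos_eq_iff)
    then show False using \<open>y \<noteq> ?r\<close> by blast
  qed
  then show "\<exists>z\<in>neighbors parent_tree x.
      {y, z} \<in> induced_edges E (neighbors parent_tree x) \<and> pos y < pos z"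
    using child_adjacent_later_tree_neighbor[OF \<open>y \<in> V\<close>] y
    by (auto simp: \<open>x = parent y\<close> induced_edges_def)
qed

lemma lcst_parent_tree: "locally_connected_spanning_tree V E parent_tree"
  using spanning_tree_parent_tree parent_tree_locally_connected
  by (simp add: locally_connected_spanning_tree_def)

end

subsection \<open>Necessity\<close>

lemma connected_on_suffix:
  assumes "connected_on E (V - {x})" "{v \<in> V - {x}. i \<le> pos v} \<noteq> {}"
  shows "connected_on E {v \<in> V - {x}. i \<le> pos v}"
  using assms(2)
proof (induction i)
  case 0
  have "{v \<in> V - {x}. 0 \<le> pos v} = V - {x}" by auto
  then show ?case using assms(1) by simp
next
  case (Suc i)
  let ?S = "{v \<in> V - {x}. i \<le> pos v}"
  obtain v where "v \<in> V" "Suc i \<le> pos v" using Suc.prems by blast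
  then have "i < length vs" using pos_less[of v] by simp
  then have suffix: "{v \<in> V - {x}. Suc i \<le> pos v} = ?S - {vs ! i}"
    using nth_pos pos_nth[of i] by (auto simp: Suc_le_eq le_less)
  have "simplicial E ?S (vs ! i)"
    unfolding simplicial_def
  proof (intro ballI impI)
    fix a b
    assume "a \<in> ?S" "b \<in> ?S" and "{vs ! i, a} \<in> E" "{vs ! i, b} \<in> E" "a \<noteq> b"
    moreover from this(1-4) have "i \<noteq> pos a" "i \<noteq> pos b"
      using edgeD(3) nth_pos by blast+
    ultimately show "{a, b} \<in> E"
      using pos_nth[OF \<open>i < length vs\<close>]
      by (intro higher_neighbors_adjacent[of a "vs ! i" b])
        (auto simp: higher_neighbors_def in_neighbors_iff)
  qed
  moreover have "?S \<noteq> {vs ! i}" "?S \<noteq> {}" using Suc.prems unfolding suffix by auto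
  ultimately show ?case
    unfolding suffix by (intro connected_on_delete_simplicial Suc.IH)
qed

lemma lcst_imp_higher_neighbor_avoiding:
  assumes lcst: "locally_connected_spanning_tree V E T"
    and v: "v \<in> V" and x: "x \<in> V - {v}" and w: "w \<in> V - {x}" "pos v < pos w"
  shows "\<exists>u\<in>higher_neighbors v. u \<noteq> x"
proof -
  let ?S = "{u \<in> V - {x}. pos v \<le> pos u}"
  have S: "v \<in> ?S" "w \<in> ?S" using v x w by auto
  have "connected_on E (V - {x})" using lcst_imp_connected_on_delete[OF graph lcst] x by blast
  then have "connected_on E ?S" using S by (intro connected_on_suffix) blast+
  then have "(v, w) \<in> (adjacency (induced_edges E ?S))\<^sup>*" using S by (rule connected_graph_rtrancl)
  moreover have "v \<noteq> w" using w(2) by blast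
  ultimately obtain u where u: "{v, u} \<in> E" "u \<in> ?S"
    by (meson converse_rtranclE in_adjacency_iff in_induced_edges_iff)
  then have "pos v \<noteq> pos u" using edgeD(3) v pos_eq_iff by blast
  then show ?thesis using u by (auto simp: higher_neighbors_def in_neighbors_iff)
qed

lemma card_later_vertices:
  assumes "v \<in> V"
  shows "card {w \<in> V. pos v < pos w} = length vs - Suc (pos v)"
proof -
  have "bij_betw pos {w \<in> V. pos v < pos w} {Suc (pos v)..<length vs}"
    by (rule bij_betw_byWitness[where f' = "(!) vs"]) (auto simp: pos_less nth_in_V nth_pos pos_nth)
  then show ?thesis by (simp add: bij_betw_same_card)
qed

lemma lcst_imp_enough_higher_neighbors:
  assumes lcst: "locally_connected_spanning_tree V E T" and "3 \<le> card V"
  shows enough_higher_neighbors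
  unfolding enough_higher_neighbors_def
proof (intro ballI, rule ccontr)
  fix v assume v: "v \<in> V"
  define L where "L = {w \<in> V. pos v < pos w}"
  assume "\<not> min 2 (length vs - Suc (pos v)) \<le> card (higher_neighbors v)"
  then have few: "card (higher_neighbors v) < 2" "card (higher_neighbors v) < card L"
    by (auto simp: L_def card_later_vertices[OF v])
  have finite: "finite (higher_neighbors v)"
    by (rule finite_subset[OF _ finite_V])
      (use neighbors_subset in \<open>auto simp: higher_neighbors_def\<close>)
  have "\<exists>x\<in>V - {v}. higher_neighbors v \<subseteq> {x} \<and> L - {x} \<noteq> {}"
  proof (cases "higher_neighbors v = {}")
    case True
    obtain w where w: "w \<in> L" using few(2) by fastforce
    have "card {v, w} < card V" using card_insert_le_m1[of 2 "{w}" v] assms(2) by simp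
    then obtain x where "x \<in> V" "x \<notin> {v, w}"
      by (metis card_mono finite.emptyI finite_insert not_le subsetI)
    then show ?thesis using True w by auto
  next
    case False
    then have "card (higher_neighbors v) = 1"
      using few(1) finite by (simp add: card_eq_0_iff less_2_cases_iff)
    then obtain x where x: "higher_neighbors v = {x}" by (auto simp: card_1_singleton_iff)
    then have "\<not> L \<subseteq> {x}" using few(2) by (auto dest: card_mono[rotated])
    moreover have "x \<in> V - {v}"
      using x neighbors_subset by (auto simp: higher_neighbors_def)
    ultimately show ?thesis using x by blast
  qed
  then show False using lcst_imp_higher_neighbor_avoiding[OF lcst v] by (fastforce simp: L_def)
qed

lemma ex_lcst_iff:
  assumes "3 \<le> card V"
  shows "(\<exists>T. locally_connected_spanning_tree V E T) \<longleftrightarrow> enough_higher_neighbors"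
  using lcst_imp_enough_higher_neighbors lcst_parent_tree assms length_vs by auto

end

section \<open>Total correctness with time bounds\<close>

definition terminates :: "nat \<Rightarrow> com \<Rightarrow> nat \<Rightarrow> (state \<Rightarrow> bool) \<Rightarrow> state \<Rightarrow> bool" where
  "terminates W c t Q s \<longleftrightarrow> (\<exists>t' s'. exec W c s t' s' \<and> t' \<le> t \<and> Q s')"

text \<open>Meant for loop-free programs; the values of \<open>wp\<close> and \<open>cost\<close> for \<open>While\<close> are junk.\<close>

fun wp :: "nat \<Rightarrow> com \<Rightarrow> (state \<Rightarrow> bool) \<Rightarrow> state \<Rightarrow> bool" where
  "wp W Skip Q s \<longleftrightarrow> Q s"
| "wp W (Assign x e) Q s \<longleftrightarrow> afits W e s \<and> Q (s\<lparr>reg := (reg s)(x := aval e s)\<rparr>)"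
| "wp W (Store a i e) Q s \<longleftrightarrow> afits W i s \<and> afits W e s \<and>
     Q (s\<lparr>arr := (arr s)(a := (arr s a)(aval i s := aval e s))\<rparr>)"
| "wp W (Seq c1 c2) Q s \<longleftrightarrow> wp W c1 (wp W c2 Q) s"
| "wp W (Cond b c1 c2) Q s \<longleftrightarrow> bfits W b s \<and> (if bval b s then wp W c1 Q s else wp W c2 Q s)"
| "wp W (While b c) Q s \<longleftrightarrow> False"

fun cost :: "com \<Rightarrow> nat" where
  "cost Skip = 1"
| "cost (Assign x e) = acost e + 1"
| "cost (Store a i e) = acost i + acost e + 1"
| "cost (Seq c1 c2) = cost c1 + cost c2"
| "cost (Cond b c1 c2) = bcost b + cost c1 + cost c2"
| "cost (While b c) = 0"

lemma wp_mono: "wp W c Q s \<Longrightarrow> (\<And>s'. Q s' \<Longrightarrow> Q' s') \<Longrightarrow> wp W c Q' s"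
proof (induction c arbitrary: Q Q' s)
  case (Seq c1 c2)
  show ?case using Seq.prems by (auto intro: Seq.IH)
qed (auto split: if_splits)

lemma terminatesI: "exec W c s t' s' \<Longrightarrow> t' \<le> t \<Longrightarrow> Q s' \<Longrightarrow> terminates W c t Q s"
  by (auto simp: terminates_def)

lemma terminatesE:
  assumes "terminates W c t Q s"
  obtains t' s' where "exec W c s t' s'" "t' \<le> t" "Q s'"
  using assms by (auto simp: terminates_def)

lemma terminates_mono:
  "terminates W c t Q s \<Longrightarrow> t \<le> t' \<Longrightarrow> (\<And>s'. Q s' \<Longrightarrow> Q' s') \<Longrightarrow> terminates W c t' Q' s"
  unfolding terminates_def by (meson le_trans)

lemma terminates_Seq:
  assumes "terminates W c1 t1 R s" "\<And>s1. R s1 \<Longrightarrow> terminates W c2 t2 Q s1"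
  shows "terminates W (Seq c1 c2) (t1 + t2) Q s"
  using assms exec.Seq unfolding terminates_def by (meson add_mono)

lemma terminates_wp: "wp W c Q s \<Longrightarrow> terminates W c (cost c) Q s"
proof (induction c arbitrary: Q s)
  case (Seq c1 c2)
  then show ?case by (auto intro: terminates_Seq[where R = "wp W c2 Q"])
next
  case (Cond b c1 c2)
  show ?case
  proof (cases "bval b s")
    case True
    then have "terminates W c1 (cost c1) Q s" using Cond by simp
    then show ?thesis
      using True Cond.prems by (auto elim!: terminatesE intro!: terminatesI[OF exec.CondTrue])
  next
    case False
    then have "terminates W c2 (cost c2) Q s" using Cond by simp
    then show ?thesis
      using False Cond.prems by (auto elim!: terminatesE intro!: terminatesI[OF exec.CondFalse])
  qed
qed (auto intro: terminatesI[OF exec.Skip] terminatesI[OF exec.Assign] terminatesI[OF exec.Store])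

lemma terminates_WhileTrue:
  assumes "bfits W b s" "bval b s"
    and "terminates W c t1 R s" "\<And>s1. R s1 \<Longrightarrow> terminates W (While b c) t2 Q s1"
  shows "terminates W (While b c) (bcost b + t1 + t2) Q s"
proof -
  obtain t1' s1 where c: "exec W c s t1' s1" "t1' \<le> t1" "R s1" using assms(3) by (rule terminatesE)
  from assms(4)[OF this(3)] obtain t2' s2
    where "exec W (While b c) s1 t2' s2" "t2' \<le> t2" "Q s2" by (rule terminatesE)
  with c show ?thesis by (intro terminatesI[OF exec.WhileTrue[OF assms(1,2)]] add_mono) simp_all
qed

definition for_upto :: "string \<Rightarrow> aexp \<Rightarrow> com \<Rightarrow> com" where
  "for_upto x e c = While (Less (Reg x) e) (Seq c (Assign x (Plus (Reg x) (Const 1))))"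

lemma terminates_for_upto:
  assumes bound: "\<And>i s. I i s \<Longrightarrow> a \<le> i \<Longrightarrow> i \<le> b \<Longrightarrow> reg s x = i \<and> afits W e s \<and> aval e s = b"
    and body: "\<And>i s. I i s \<Longrightarrow> a \<le> i \<Longrightarrow> i < b \<Longrightarrow>
      terminates W c (T i) (\<lambda>s'. reg s' x = i \<and> I (Suc i) (s'\<lparr>reg := (reg s')(x := Suc i)\<rparr>)) s"
    and init: "I a s" "a \<le> b" and "b \<le> W"
  shows "terminates W (for_upto x e c) (acost e + 2 + (\<Sum>i=a..<b. T i + acost e + 6)) (I b) s"
  using \<open>a \<le> b\<close> \<open>I a s\<close>
proof (induction a arbitrary: s rule: inc_induct)
  case base
  show ?case
    by (rule terminatesI, unfold for_upto_def, rule exec.WhileFalse)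
      (use bound[OF base \<open>a \<le> b\<close> order.refl] \<open>b \<le> W\<close> base in auto)
next
  case (step n)
  let ?next = "Assign x (Plus (Reg x) (Const 1))"
  note here = bound[OF step.prems step.hyps(1) less_imp_le[OF step.hyps(2)]]
  have "wp W ?next (I (Suc n)) s'"
    if "reg s' x = n \<and> I (Suc n) (s'\<lparr>reg := (reg s')(x := Suc n)\<rparr>)" for s'
    using that step.hyps(2) \<open>b \<le> W\<close> by simp
  then have "terminates W (Seq c ?next) (T n + cost ?next) (I (Suc n)) s"
    by (intro terminates_Seq[OF body[OF step.prems step.hyps]] terminates_wp)
  then have "terminates W (for_upto x e c)
      (bcost (Less (Reg x) e) + (T n + cost ?next) +
        (acost e + 2 + (\<Sum>i=Suc n..<b. T i + acost e + 6))) (I b) s"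
    unfolding for_upto_def
    by (rule terminates_WhileTrue[rotated 2])
      (use step.IH here step.hyps \<open>b \<le> W\<close> in \<open>auto simp: for_upto_def\<close>)
  then show ?case
    by (rule terminates_mono) (simp_all add: sum.atLeast_Suc_lessThan[OF step.hyps(2)])
qed

lemma terminates_init_for_upto:
  assumes "wp W init (I 0) s"
    and "\<And>i s. I i s \<Longrightarrow> i \<le> b \<Longrightarrow> reg s x = i \<and> afits W e s \<and> aval e s = b"
    and "\<And>i s. I i s \<Longrightarrow> i < b \<Longrightarrow>
      terminates W c (T i) (\<lambda>s'. reg s' x = i \<and> I (Suc i) (s'\<lparr>reg := (reg s')(x := Suc i)\<rparr>)) s"
    and "b \<le> W"
  shows "terminates W (Seq init (for_upto x e c))
    (cost init + (acost e + 2 + (\<Sum>i<b. T i + acost e + 6))) (I b) s"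
  unfolding atLeast0LessThan[symmetric]
  by (rule terminates_Seq[OF terminates_wp[OF assms(1)]], rule terminates_for_upto[where I = I])
    (use assms in auto)

section \<open>The program\<close>

text \<open>The arrays \<open>top\<close> and \<open>guide\<close> are indexed by vertices but hold positions in the order.\<close>

definition index_order :: com where
  "index_order = Seq (Assign ''i'' (Const 0)) (for_upto ''i'' (Reg ''n'')
     (Seq (Store ''pos'' (Load ''order'' (Reg ''i'')) (Reg ''i''))
     (Seq (Store ''top'' (Load ''order'' (Reg ''i'')) (Reg ''i''))
          (Store ''guide'' (Load ''order'' (Reg ''i'')) (Reg ''i'')))))"

definition scan_list :: "com \<Rightarrow> com" where
  "scan_list c = for_upto ''e'' (Load ''offset'' (Plus (Reg ''v'') (Const 1)))
     (Seq (Assign ''u'' (Load ''adj'' (Reg ''e''))) c)"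

definition scan_arcs :: "com \<Rightarrow> com" where
  "scan_arcs c = Seq (Seq (Assign ''v'' (Const 0)) (Assign ''e'' (Const 0)))
     (for_upto ''v'' (Reg ''n'') (scan_list c))"

definition update_top :: com where
  "update_top = Cond (Less (Load ''top'' (Reg ''v'')) (Load ''pos'' (Reg ''u'')))
     (Store ''top'' (Reg ''v'') (Load ''pos'' (Reg ''u''))) Skip"

definition update_guide :: com where
  "update_guide = Cond
     (And (Less (Load ''pos'' (Reg ''v'')) (Load ''guide'' (Reg ''u'')))
          (Less (Load ''pos'' (Reg ''u'')) (Load ''top'' (Reg ''v''))))
     (Store ''guide'' (Reg ''u'') (Load ''pos'' (Reg ''v''))) Skip"

definition count_higher :: com where
  "count_higher = Cond (Less (Load ''pos'' (Reg ''v'')) (Load ''pos'' (Reg ''u'')))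
     (Store ''higher'' (Reg ''v'') (Plus (Load ''higher'' (Reg ''v'')) (Const 1))) Skip"

definition write_parent_edge :: com where
  "write_parent_edge = Seq (Store ''end1'' (Reg ''i'') (Load ''order'' (Reg ''i'')))
     (Store ''end2'' (Reg ''i'') (Load ''order'' (Load ''top'' (Load ''order''
        (Load ''guide'' (Load ''order'' (Reg ''i'')))))))"

definition test_higher :: com where
  "test_higher = Cond
     (And (Less (Load ''higher'' (Load ''order'' (Reg ''i''))) (Const 2))
          (Less (Load ''higher'' (Load ''order'' (Reg ''i'')))
                (Minus (Reg ''n'') (Plus (Reg ''i'') (Const 1)))))
     (Assign ''answer'' (Const 0)) Skip"

definition write_output :: com where
  "write_output = Seq (Seq (Assign ''answer'' (Const 1)) (Assign ''i'' (Const 0)))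
     (for_upto ''i'' (Minus (Reg ''n'') (Const 1)) (Seq write_parent_edge test_higher))"

definition lcst_program :: com where
  "lcst_program = Seq index_order (Seq (scan_arcs update_top)
     (Seq (scan_arcs (Seq update_guide count_higher)) write_output))"

section \<open>Adjacency lists\<close>

lemma nth_concat_offset:
  assumes "i < length xss" "k < length (xss ! i)"
  shows "concat xss ! (length (concat (take i xss)) + k) = xss ! i ! k"
proof -
  have "concat xss = concat (take i xss) @ xss ! i @ concat (drop (Suc i) xss)"
    using id_take_nth_drop[OF assms(1)] by (metis concat.simps(2) concat_append)
  then show ?thesis using assms(2) by (simp add: nth_append)
qed

lemma sum_length_nth: "(\<Sum>i<length xss. length (xss ! i)) = length (concat xss)"
  by (simp add: length_concat sum_list_sum_nth atLeast0LessThan)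

lemma sum_card_neighbors:
  assumes "simple_graph V E"
  shows "(\<Sum>v\<in>V. card (neighbors E v)) = 2 * card E"
proof -
  have V: "finite V" and E: "\<And>e. e \<in> E \<Longrightarrow> e \<subseteq> V \<and> card e = 2"
    using assms by (auto simp: simple_graph_def)
  have "finite E" by (rule finite_subset[of _ "Pow V"]) (use V E in auto)
  have "card (neighbors E v) = card {e \<in> E. v \<in> e}" for v
  proof (rule bij_betw_same_card)
    have "{e \<in> E. v \<in> e} \<subseteq> (\<lambda>u. {u, v}) ` neighbors E v"
    proof safe
      fix e assume "e \<in> E" "v \<in> e"
      then obtain u where "e = {u, v}" using E[of e] by (auto simp: card_2_iff)
      then show "e \<in> (\<lambda>u. {u, v}) ` neighbors E v" using \<open>e \<in> E\<close> by (auto simp: neighbors_def)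
    qed
    then show "bij_betw (\<lambda>u. {u, v}) (neighbors E v) {e \<in> E. v \<in> e}"
      by (auto simp: bij_betw_def inj_on_def neighbors_def doubleton_eq_iff)
  qed
  moreover have "(\<Sum>v\<in>V. card {e \<in> E. v \<in> e}) = 2 * card E"
  proof (rule sum_multicount[OF V \<open>finite E\<close>], rule ballI)
    fix e assume "e \<in> E"
    then have "{v \<in> V. v \<in> e} = e" using E by blast
    then show "card {v \<in> V. v \<in> e} = 2" using E[OF \<open>e \<in> E\<close>] by simp
  qed
  ultimately show ?thesis by simp
qed

lemma length_concat_adjacency_lists:
  assumes "adjacency_lists n E adj" "simple_graph {..<n} E"
  shows "length (concat adj) = 2 * card E"
proof -
  have "length (concat adj) = (\<Sum>v<n. length (adj ! v))"
    using assms(1) sum_length_nth[of adj] by (simp add: adjacency_lists_def)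
  also have "\<dots> = (\<Sum>v<n. card (neighbors E v))"
    using assms(1) by (intro sum.cong) (auto simp: adjacency_lists_def simp flip: distinct_card)
  finally show ?thesis using sum_card_neighbors[OF assms(2)] by simp
qed

locale lcst_input = strong_elimination "{..<n}" E vs
  for n :: nat and E :: "nat set set" and vs :: "nat list" +
  fixes adj :: "nat list list" and W :: nat
  assumes adj: "adjacency_lists n E adj"
    and W: "2 \<le> W" "n \<le> W" "length (concat adj) \<le> W"
begin

definition offset :: "nat \<Rightarrow> nat" where
  "offset v = length (concat (take v adj))"

definition arcs :: "(nat \<times> nat) list" where
  "arcs = concat (map (\<lambda>v. map (Pair v) (adj ! v)) [0..<n])"

lemma length_vs_n: "length vs = n"
  using length_vs by simp

lemma length_adj: "length adj = n"
  using adj by (simp add: adjacency_lists_def)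

lemma offset_0: "offset 0 = 0" and offset_n: "offset n = length (concat adj)"
  by (simp_all add: offset_def length_adj)

lemma offset_Suc: "v < n \<Longrightarrow> offset (Suc v) = offset v + length (adj ! v)"
  by (simp add: offset_def take_Suc_conv_app_nth length_adj)

lemma offset_le: "offset v \<le> length (concat adj)"
proof -
  have "concat adj = concat (take v adj) @ concat (drop v adj)"
    by (simp flip: concat_append)
  then show ?thesis by (metis length_append le_add1 offset_def)
qed

lemma in_set_arcs_iff: "(v, u) \<in> set arcs \<longleftrightarrow> {v, u} \<in> E"
  using adj edgeD[of v u] by (auto simp: arcs_def adjacency_lists_def in_neighbors_iff image_iff)

lemma distinct_arcs: "distinct arcs"
proof -
  have "distinct (concat (map (\<lambda>v. map (Pair v) (adj ! v)) [0..<k]))" if "k \<le> n" for k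
    using that adj by (induction k) (auto simp: distinct_map inj_on_def adjacency_lists_def)
  then show ?thesis by (simp add: arcs_def)
qed

lemma nth_arcs:
  assumes "v < n" "offset v \<le> e" "e < offset (Suc v)"
  shows "arcs ! e = (v, concat adj ! e)"
proof -
  let ?lists = "map (\<lambda>v. map (Pair v) (adj ! v)) [0..<n]"
  obtain k where k: "e = offset v + k" "k < length (adj ! v)"
    using assms offset_Suc by (metis add_less_cancel_left le_Suc_ex)
  have "map length ?lists = map length adj"
    by (rule nth_equalityI) (simp_all add: length_adj)
  then have "length (concat (take v ?lists)) = offset v"
    by (simp only: length_concat offset_def take_map[symmetric])
  then show ?thesis
    using nth_concat_offset[of v ?lists k] nth_concat_offset[of v adj k] k assms(1)
    by (simp add: arcs_def offset_def length_adj)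
qed

lemma length_arcs: "length arcs = length (concat adj)"
proof -
  have "map (\<lambda>v. length (adj ! v)) [0..<n] = map length adj"
    by (rule nth_equalityI) (simp_all add: length_adj)
  then show ?thesis by (simp add: arcs_def length_concat comp_def)
qed

section \<open>Correctness and running time\<close>

definition stores :: "(string \<Rightarrow> nat \<Rightarrow> nat) \<Rightarrow> string \<Rightarrow> (nat \<Rightarrow> nat) \<Rightarrow> bool" where
  "stores A a f \<longleftrightarrow> (\<forall>v<n. A a v = f v)"

definition loaded :: "(string \<Rightarrow> nat \<Rightarrow> nat) \<Rightarrow> bool" where
  "loaded A \<longleftrightarrow> (\<forall>v\<le>n. A ''offset'' v = offset v) \<and>
     (\<forall>e<length (concat adj). A ''adj'' e = concat adj ! e) \<and> stores A ''order'' ((!) vs)"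

lemma stores_cong: "(\<And>v. v < n \<Longrightarrow> f v = g v) \<Longrightarrow> stores A a f \<longleftrightarrow> stores A a g"
  by (simp add: stores_def)

lemma stores_update_other: "a \<noteq> b \<Longrightarrow> stores (A(b := g)) a f \<longleftrightarrow> stores A a f"
  by (simp add: stores_def)

lemma loaded_update:
  "a \<notin> {''offset'', ''adj'', ''order''} \<Longrightarrow> loaded (A(a := f)) \<longleftrightarrow> loaded A"
  by (auto simp: loaded_def stores_def)

definition updated :: "string \<Rightarrow> (nat \<Rightarrow> nat) \<Rightarrow> state \<Rightarrow> state \<Rightarrow> bool" where
  "updated a f s s' \<longleftrightarrow> (\<exists>g. s' = s\<lparr>arr := (arr s)(a := g)\<rparr> \<and> (\<forall>v<n. g v = f v))"

lemma updated_refl: "stores (arr s) a f \<Longrightarrow> updated a f s s"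
  unfolding updated_def stores_def by (rule exI[of _ "arr s a"]) simp

lemma updated_cell:
  "stores (arr s) a f \<Longrightarrow> updated a (f(v := k)) s (s\<lparr>arr := (arr s)(a := (arr s a)(v := k))\<rparr>)"
  by (auto simp: updated_def stores_def)

lemma updatedE:
  assumes "updated a f s s'"
  obtains g where "s' = s\<lparr>arr := (arr s)(a := g)\<rparr>" "stores (arr s') a f"
  using assms by (auto simp: updated_def stores_def)

lemma loaded_input_state: "loaded (arr (input_state n m adj vs))"
  by (simp add: loaded_def stores_def input_state_def array_of_def offset_def length_vs_n
      del: upt_Suc)

subsection \<open>Scanning all arcs\<close>

text \<open>\<open>I D A\<close> describes the arrays \<open>A\<close> at the time when the arcs in \<open>D\<close> have been scanned.\<close>

definition scan_inv ::
  "((nat \<times> nat) set \<Rightarrow> (string \<Rightarrow> nat \<Rightarrow> nat) \<Rightarrow> bool) \<Rightarrow> nat \<Rightarrow> nat \<Rightarrow> state \<Rightarrow> bool" where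
  "scan_inv I v e s \<longleftrightarrow>
     reg s ''n'' = n \<and> reg s ''v'' = v \<and> reg s ''e'' = e \<and> I (set (take e arcs)) (arr s)"

context
  fixes c :: com and I :: "(nat \<times> nat) set \<Rightarrow> (string \<Rightarrow> nat \<Rightarrow> nat) \<Rightarrow> bool"
  assumes loaded: "\<And>D A. I D A \<Longrightarrow> loaded A"
    and step: "\<And>D s. I D (arr s) \<Longrightarrow> D \<subseteq> set arcs \<Longrightarrow> (reg s ''v'', reg s ''u'') \<in> set arcs - D \<Longrightarrow>
      wp W c (\<lambda>s'. I (insert (reg s ''v'', reg s ''u'') D) (arr s') \<and> reg s' = reg s) s"
begin

lemma wp_scan_list_body:
  assumes inv: "scan_inv I v e s" and "v < n" and e: "offset v \<le> e" "e < offset (Suc v)"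
  shows "wp W (Seq (Assign ''u'' (Load ''adj'' (Reg ''e''))) c)
    (\<lambda>s'. reg s' ''e'' = e \<and> scan_inv I v (Suc e) (s'\<lparr>reg := (reg s')(''e'' := Suc e)\<rparr>)) s"
proof -
  let ?u = "concat adj ! e" and ?D = "set (take e arcs)"
  let ?s = "s\<lparr>reg := (reg s)(''u'' := ?u)\<rparr>"
  have less: "e < length arcs" using e(2) offset_le[of "Suc v"] length_arcs by simp
  have nth: "arcs ! e = (v, ?u)" using nth_arcs[OF \<open>v < n\<close> e] .
  have D: "set (take (Suc e) arcs) = insert (v, ?u) ?D"
    using take_Suc_conv_app_nth[OF less] nth by simp
  have "arcs ! e \<notin> ?D"
    using distinct_arcs less by (auto simp: in_set_conv_nth nth_eq_iff_index_eq)
  then have arc: "(v, ?u) \<in> set arcs - ?D" using nth_mem[OF less] nth by simp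
  then have "?u < n" using edgeD(2)[of v ?u] by (simp add: in_set_arcs_iff)
  have "wp W c (\<lambda>s'. I (insert (v, ?u) ?D) (arr s') \<and> reg s' = reg ?s) ?s"
    using step[of ?D ?s] inv arc by (auto simp: scan_inv_def dest: in_set_takeD)
  then have "wp W c (\<lambda>s'. reg s' ''e'' = e \<and>
      scan_inv I v (Suc e) (s'\<lparr>reg := (reg s')(''e'' := Suc e)\<rparr>)) ?s"
    by (rule wp_mono) (use inv D in \<open>simp add: scan_inv_def\<close>)
  moreover have "arr s ''adj'' e = ?u" "e \<le> W" "?u \<le> W"
    using inv loaded less W \<open>?u < n\<close> by (auto simp: scan_inv_def loaded_def length_arcs)
  ultimately show ?thesis using inv by (simp add: scan_inv_def)
qed

lemma terminates_scan_list:
  assumes "v < n" "scan_inv I v (offset v) s"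
  shows "terminates W (scan_list c) (6 + length (adj ! v) * (cost c + 13))
    (scan_inv I v (offset (Suc v))) s"
proof -
  let ?end = "Load ''offset'' (Plus (Reg ''v'') (Const 1))"
  let ?body = "Seq (Assign ''u'' (Load ''adj'' (Reg ''e''))) c"
  have "terminates W (scan_list c)
      (acost ?end + 2 + (\<Sum>e=offset v..<offset (Suc v). cost ?body + acost ?end + 6))
      (scan_inv I v (offset (Suc v))) s"
    unfolding scan_list_def
  proof (rule terminates_for_upto[where I = "scan_inv I v", OF _ _ assms(2)])
    fix e s assume inv: "scan_inv I v e s"
    then have "loaded (arr s)" using loaded by (auto simp: scan_inv_def)
    then show "reg s ''e'' = e \<and> afits W ?end s \<and> aval ?end s = offset (Suc v)"
      using inv assms(1) W offset_le[of "Suc v"] by (auto simp: scan_inv_def loaded_def)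
  next
    fix e s assume "scan_inv I v e s" "offset v \<le> e" "e < offset (Suc v)"
    then show "terminates W ?body (cost ?body)
        (\<lambda>s'. reg s' ''e'' = e \<and> scan_inv I v (Suc e) (s'\<lparr>reg := (reg s')(''e'' := Suc e)\<rparr>)) s"
      by (intro terminates_wp wp_scan_list_body assms(1))
  qed (use assms(1) offset_le[of "Suc v"] W in \<open>simp_all add: offset_Suc\<close>)
  then show ?thesis by (rule terminates_mono) (simp_all add: offset_Suc[OF assms(1)])
qed

lemma terminates_scan_arcs:
  assumes "I {} (arr s)" "reg s ''n'' = n"
  shows "terminates W (scan_arcs c) (7 + 13 * n + length (concat adj) * (cost c + 13))
    (\<lambda>s'. I (set arcs) (arr s') \<and> reg s' ''n'' = n) s"
proof -
  let ?init = "Seq (Assign ''v'' (Const 0)) (Assign ''e'' (Const 0))"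
  have "terminates W (scan_arcs c) (cost ?init + (acost (Reg ''n'') + 2 +
      (\<Sum>v<n. (6 + length (adj ! v) * (cost c + 13)) + acost (Reg ''n'') + 6)))
      (scan_inv I n (offset n)) s"
    unfolding scan_arcs_def
  proof (rule terminates_init_for_upto[where I = "\<lambda>v. scan_inv I v (offset v)"])
    show "wp W ?init (scan_inv I 0 (offset 0)) s"
      using assms by (simp add: scan_inv_def offset_0)
    fix v s assume v: "scan_inv I v (offset v) s" "v < n"
    show "terminates W (scan_list c) (6 + length (adj ! v) * (cost c + 13))
        (\<lambda>s'. reg s' ''v'' = v \<and>
          scan_inv I (Suc v) (offset (Suc v)) (s'\<lparr>reg := (reg s')(''v'' := Suc v)\<rparr>)) s"
      by (rule terminates_mono[OF terminates_scan_list[OF v(2,1)]]) (simp_all add: scan_inv_def)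
  qed (use W in \<open>auto simp: scan_inv_def\<close>)
  then show ?thesis
    by (rule terminates_mono)
      (simp_all add: sum.distrib sum_length_nth[of adj, unfolded length_adj] scan_inv_def offset_n
        length_arcs flip: sum_distrib_right)
qed

end

subsection \<open>The values computed by the scans\<close>

definition top_pos :: "(nat \<times> nat) set \<Rightarrow> nat \<Rightarrow> nat" where
  "top_pos D v = Max (pos ` insert v (D `` {v}))"

definition guide_pos :: "(nat \<times> nat) set \<Rightarrow> nat \<Rightarrow> nat" where
  "guide_pos D u = Min (pos ` insert u {w. (w, u) \<in> D \<and> pos u < pos (last_neighbor w)})"

definition higher_count :: "(nat \<times> nat) set \<Rightarrow> nat \<Rightarrow> nat" where
  "higher_count D v = card {u. (v, u) \<in> D \<and> pos v < pos u}"

lemma arcs_less: "D \<subseteq> set arcs \<Longrightarrow> (v, u) \<in> D \<Longrightarrow> v < n \<and> u < n"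
  using edgeD in_set_arcs_iff by (meson lessThan_iff subsetD)

lemma finite_arcs_subset:
  assumes "D \<subseteq> set arcs"
  shows "finite (D `` {v})" "finite {u. (v, u) \<in> D \<and> P u}" "finite {w. (w, v) \<in> D \<and> P w}"
  by (rule finite_subset[of _ "{..<n}"]; use arcs_less[OF assms] in auto)+

lemma pos_less_n: "v < n \<Longrightarrow> pos v < n"
  using pos_less length_vs_n by simp

lemma nth_less_n: "i < n \<Longrightarrow> vs ! i < n"
  using nth_in_V length_vs_n by simp

lemma last_neighbor_less_n: "v < n \<Longrightarrow> last_neighbor v < n"
  using last_neighbor_in_V by simp

lemma top_pos_empty: "top_pos {} = pos" and guide_pos_empty: "guide_pos {} = pos"
  and higher_count_empty: "higher_count {} = (\<lambda>_. 0)"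
  by (simp_all add: fun_eq_iff top_pos_def guide_pos_def higher_count_def)

lemma top_pos_insert:
  assumes "D \<subseteq> set arcs"
  shows "top_pos (insert (v, u) D) = (top_pos D)(v := max (top_pos D v) (pos u))"
proof
  fix w
  define N where "N D = pos ` insert w (D `` {w})" for D
  have "N (insert (v, u) D) = (if w = v then insert (pos u) (N D) else N D)"
    by (auto simp: N_def)
  moreover have "finite (N D)" "N D \<noteq> {}"
    using finite_arcs_subset(1)[OF assms] by (auto simp: N_def)
  moreover have "top_pos D w = Max (N D)" for D by (simp add: top_pos_def N_def)
  ultimately show "top_pos (insert (v, u) D) w = ((top_pos D)(v := max (top_pos D v) (pos u))) w"
    by (cases "w = v") (simp_all add: max.commute)
qed

lemma guide_pos_insert:
  assumes "D \<subseteq> set arcs"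
  shows "guide_pos (insert (v, u) D) =
    (if pos u < pos (last_neighbor v)
     then (guide_pos D)(u := min (guide_pos D u) (pos v)) else guide_pos D)"
proof
  fix w
  define C where "C D = pos ` insert w {x. (x, w) \<in> D \<and> pos w < pos (last_neighbor x)}" for D
  have "C (insert (v, u) D) =
      (if w = u \<and> pos u < pos (last_neighbor v) then insert (pos v) (C D) else C D)"
    by (auto simp: C_def)
  moreover have "finite (C D)" "C D \<noteq> {}"
    using finite_arcs_subset(3)[OF assms] by (auto simp: C_def)
  moreover have "guide_pos D w = Min (C D)" for D by (simp add: guide_pos_def C_def)
  ultimately show "guide_pos (insert (v, u) D) w = (if pos u < pos (last_neighbor v)
      then (guide_pos D)(u := min (guide_pos D u) (pos v)) else guide_pos D) w"
    by (cases "w = u") (simp_all add: min.commute)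
qed

lemma higher_count_insert:
  assumes "D \<subseteq> set arcs" "(v, u) \<notin> D"
  shows "higher_count (insert (v, u) D) =
    (if pos v < pos u then (higher_count D)(v := Suc (higher_count D v)) else higher_count D)"
proof
  fix w
  let ?H = "\<lambda>D. {x. (w, x) \<in> D \<and> pos w < pos x}"
  have "?H (insert (v, u) D) = (if w = v \<and> pos v < pos u then insert u (?H D) else ?H D)" by auto
  then show "higher_count (insert (v, u) D) w = (if pos v < pos u
      then (higher_count D)(v := Suc (higher_count D v)) else higher_count D) w"
    using finite_arcs_subset(2)[OF assms(1)] assms(2) by (simp add: higher_count_def)
qed

lemma top_pos_less_n:
  assumes "D \<subseteq> set arcs" "v < n"
  shows "top_pos D v < n"
  unfolding top_pos_def using finite_arcs_subset(1)[OF assms(1)] arcs_less[OF assms(1)] assms(2)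
  by (subst Max_less_iff) (auto simp: pos_less_n)

lemma guide_pos_less_n:
  assumes "D \<subseteq> set arcs" "u < n"
  shows "guide_pos D u < n"
proof -
  have "guide_pos D u \<le> pos u"
    unfolding guide_pos_def using finite_arcs_subset(3)[OF assms(1)] by (intro Min_le) auto
  then show ?thesis using pos_less_n[OF assms(2)] by simp
qed

lemma higher_count_le_n: "D \<subseteq> set arcs \<Longrightarrow> higher_count D v \<le> n"
  unfolding higher_count_def
  by (rule order_trans[OF card_mono[of "{..<n}"]]) (use arcs_less in auto)

lemma top_pos_arcs: "v < n \<Longrightarrow> top_pos (set arcs) v = pos (last_neighbor v)"
proof -
  assume "v < n"
  have "insert v (set arcs `` {v}) = closed_neighborhood E v"
    by (auto simp: in_set_arcs_iff in_closed_neighborhood_iff)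
  then show ?thesis
    using pos_latest[OF closed_neighborhood_subset] \<open>v < n\<close>
    by (simp add: top_pos_def last_neighbor_def closed_neighborhood_def)
qed

lemma guide_pos_arcs: "u < n \<Longrightarrow> guide_pos (set arcs) u = pos (first (guides u))"
proof -
  assume "u < n"
  have "insert u {w. (w, u) \<in> set arcs \<and> pos u < pos (last_neighbor w)} = guides u"
    by (auto simp: in_set_arcs_iff guides_def neighbors_def)
  then show ?thesis
    using pos_first[OF guides_subset] \<open>u < n\<close> by (simp add: guide_pos_def guides_def)
qed

lemma higher_count_arcs: "higher_count (set arcs) v = card (higher_neighbors v)"
  by (simp add: higher_count_def higher_neighbors_def in_set_arcs_iff in_neighbors_iff)

subsection \<open>The phases of the program\<close>

definition top_inv :: "(nat \<times> nat) set \<Rightarrow> (string \<Rightarrow> nat \<Rightarrow> nat) \<Rightarrow> bool" where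
  "top_inv D A \<longleftrightarrow> loaded A \<and> stores A ''pos'' pos \<and> stores A ''top'' (top_pos D) \<and>
     stores A ''guide'' pos \<and> stores A ''higher'' (\<lambda>_. 0)"

definition guide_inv :: "(nat \<times> nat) set \<Rightarrow> (string \<Rightarrow> nat \<Rightarrow> nat) \<Rightarrow> bool" where
  "guide_inv D A \<longleftrightarrow> loaded A \<and> stores A ''pos'' pos \<and> stores A ''top'' (\<lambda>v. pos (last_neighbor v)) \<and>
     stores A ''guide'' (guide_pos D) \<and> stores A ''higher'' (higher_count D)"

lemmas array_update = loaded_update stores_update_other

lemma terminates_index_order:
  assumes "loaded (arr s)" "reg s ''n'' = n" "stores (arr s) ''higher'' (\<lambda>_. 0)"
  shows "terminates W index_order (5 + 19 * n) (\<lambda>s'. top_inv {} (arr s') \<and> reg s' ''n'' = n) s"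
proof -
  define I where "I i s \<longleftrightarrow> loaded (arr s) \<and> stores (arr s) ''higher'' (\<lambda>_. 0) \<and>
      reg s ''n'' = n \<and> reg s ''i'' = i \<and>
      (\<forall>a\<in>{''pos'', ''top'', ''guide''}. \<forall>j<i. arr s a (vs ! j) = j)" for i and s :: state
  let ?body = "Seq (Store ''pos'' (Load ''order'' (Reg ''i'')) (Reg ''i''))
     (Seq (Store ''top'' (Load ''order'' (Reg ''i'')) (Reg ''i''))
          (Store ''guide'' (Load ''order'' (Reg ''i'')) (Reg ''i'')))"
  have loop: "terminates W index_order (cost (Assign ''i'' (Const 0)) + (acost (Reg ''n'') + 2 +
      (\<Sum>i<n. cost ?body + acost (Reg ''n'') + 6))) (I n) s"
    unfolding index_order_def
  proof (rule terminates_init_for_upto[where I = I, OF _ _ terminates_wp])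
    show "wp W (Assign ''i'' (Const 0)) (I 0) s" using assms by (simp add: I_def)
    fix i s assume I: "I i s" and i: "i < n"
    have "arr s ''order'' i = vs ! i" using I i by (simp add: I_def loaded_def stores_def)
    moreover have "vs ! j \<noteq> vs ! i" if "j < i" for j
      using that i distinct_vs length_vs_n by (simp add: nth_eq_iff_index_eq)
    ultimately show "wp W ?body
        (\<lambda>s'. reg s' ''i'' = i \<and> I (Suc i) (s'\<lparr>reg := (reg s')(''i'' := Suc i)\<rparr>)) s"
      using I i W nth_less_n[OF i] by (auto simp: I_def array_update less_Suc_eq)
  qed (use W in \<open>auto simp: I_def\<close>)
  have top_inv: "top_inv {} (arr s) \<and> reg s ''n'' = n" if "I n s" for s
  proof -
    have "stores (arr s) a pos" if "a \<in> {''pos'', ''top'', ''guide''}" for a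
      using \<open>I n s\<close> that nth_pos pos_less_n unfolding I_def stores_def by (metis lessThan_iff)
    then show ?thesis using that by (simp add: top_inv_def I_def top_pos_empty)
  qed
  from loop show ?thesis by (rule terminates_mono) (simp_all add: top_inv)
qed

lemma wp_update_top:
  assumes D: "D \<subseteq> set arcs" and less: "reg s ''v'' < n" "reg s ''u'' < n"
    and stores: "stores (arr s) ''pos'' pos" "stores (arr s) ''top'' (top_pos D)"
  shows "wp W update_top (updated ''top'' (top_pos (insert (reg s ''v'', reg s ''u'') D)) s) s"
proof -
  let ?v = "reg s ''v''" and ?u = "reg s ''u''"
  have vals: "arr s ''pos'' ?u = pos ?u" "arr s ''top'' ?v = top_pos D ?v"
    using stores less by (simp_all add: stores_def)
  have bounds: "pos ?u < n" "top_pos D ?v < n" "n \<le> W"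
    using pos_less_n[OF less(2)] top_pos_less_n[OF D less(1)] W by simp_all
  show ?thesis
  proof (cases "top_pos D ?v < pos ?u")
    case True
    then have "top_pos (insert (?v, ?u) D) = (top_pos D)(?v := pos ?u)"
      by (simp add: top_pos_insert[OF D] max_def)
    then show ?thesis
      using updated_cell[OF stores(2)] True vals bounds less by (simp add: update_top_def)
  next
    case False
    then have "top_pos (insert (?v, ?u) D) = top_pos D" by (simp add: top_pos_insert[OF D] max_def)
    then show ?thesis
      using updated_refl[OF stores(2)] False vals bounds less by (simp add: update_top_def)
  qed
qed

lemma wp_update_guide:
  assumes D: "D \<subseteq> set arcs" and less: "reg s ''v'' < n" "reg s ''u'' < n"
    and stores: "stores (arr s) ''pos'' pos" "stores (arr s) ''top'' (\<lambda>v. pos (last_neighbor v))"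
      "stores (arr s) ''guide'' (guide_pos D)"
  shows "wp W update_guide
    (updated ''guide'' (guide_pos (insert (reg s ''v'', reg s ''u'') D)) s) s"
proof -
  let ?v = "reg s ''v''" and ?u = "reg s ''u''"
  have vals: "arr s ''pos'' ?v = pos ?v" "arr s ''pos'' ?u = pos ?u"
    "arr s ''top'' ?v = pos (last_neighbor ?v)" "arr s ''guide'' ?u = guide_pos D ?u"
    using stores less by (simp_all add: stores_def)
  have bounds: "pos ?v < n" "pos ?u < n" "pos (last_neighbor ?v) < n" "guide_pos D ?u < n" "n \<le> W"
    using less pos_less_n last_neighbor_less_n guide_pos_less_n[OF D] W by simp_all
  show ?thesis
  proof (cases "pos ?v < guide_pos D ?u \<and> pos ?u < pos (last_neighbor ?v)")
    case True
    then have "guide_pos (insert (?v, ?u) D) = (guide_pos D)(?u := pos ?v)"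
      by (simp add: guide_pos_insert[OF D] min_def)
    then show ?thesis
      using updated_cell[OF stores(3)] True vals bounds less by (simp add: update_guide_def)
  next
    case False
    then have "guide_pos (insert (?v, ?u) D) = guide_pos D"
      by (auto simp: guide_pos_insert[OF D] min_def)
    then show ?thesis
      using updated_refl[OF stores(3)] False vals bounds less by (auto simp: update_guide_def)
  qed
qed

lemma wp_count_higher:
  assumes D: "D \<subseteq> set arcs" and arc: "(reg s ''v'', reg s ''u'') \<in> set arcs - D"
    and stores: "stores (arr s) ''pos'' pos" "stores (arr s) ''higher'' (higher_count D)"
  shows "wp W count_higher
    (updated ''higher'' (higher_count (insert (reg s ''v'', reg s ''u'') D)) s) s"
proof -
  let ?v = "reg s ''v''" and ?u = "reg s ''u''"
  have less: "?v < n" "?u < n" using arc arcs_less by blast+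
  have vals: "arr s ''pos'' ?v = pos ?v" "arr s ''pos'' ?u = pos ?u"
    "arr s ''higher'' ?v = higher_count D ?v"
    using stores less by (simp_all add: stores_def)
  have bounds: "pos ?v < n" "pos ?u < n" "n \<le> W" using less pos_less_n W by simp_all
  have insert: "higher_count (insert (?v, ?u) D) = (if pos ?v < pos ?u
      then (higher_count D)(?v := Suc (higher_count D ?v)) else higher_count D)"
    using arc by (intro higher_count_insert D) simp
  show ?thesis
  proof (cases "pos ?v < pos ?u")
    case True
    have "higher_count (insert (?v, ?u) D) ?v \<le> n" using D arc by (intro higher_count_le_n) auto
    then show ?thesis
      using updated_cell[OF stores(2)] True vals bounds less by (simp add: insert count_higher_def)
  next
    case False
    then show ?thesis
      using updated_refl[OF stores(2)] vals bounds less by (simp add: insert count_higher_def)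
  qed
qed

lemma terminates_scan_update_top:
  assumes "top_inv {} (arr s)" "reg s ''n'' = n"
  shows "terminates W (scan_arcs update_top) (7 + 13 * n + 23 * length (concat adj))
    (\<lambda>s'. guide_inv {} (arr s') \<and> reg s' ''n'' = n) s"
proof -
  have scan: "terminates W (scan_arcs update_top)
      (7 + 13 * n + length (concat adj) * (cost update_top + 13))
      (\<lambda>s'. top_inv (set arcs) (arr s') \<and> reg s' ''n'' = n) s"
  proof (rule terminates_scan_arcs[where I = top_inv, OF _ _ assms])
    fix D and s :: state
    let ?v = "reg s ''v''" and ?u = "reg s ''u''"
    assume inv: "top_inv D (arr s)" and D: "D \<subseteq> set arcs" and "(?v, ?u) \<in> set arcs - D"
    then have "?v < n" "?u < n" using arcs_less by blast+
    then have "wp W update_top (updated ''top'' (top_pos (insert (?v, ?u) D)) s) s"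
      using inv by (intro wp_update_top D) (simp_all add: top_inv_def)
    then show "wp W update_top (\<lambda>s'. top_inv (insert (?v, ?u) D) (arr s') \<and> reg s' = reg s) s"
      by (rule wp_mono) (use inv in \<open>auto simp: top_inv_def array_update elim!: updatedE\<close>)
  qed (simp add: top_inv_def)
  have guide_inv: "guide_inv {} A" if "top_inv (set arcs) A" for A
  proof -
    have "stores A ''top'' (top_pos (set arcs)) \<longleftrightarrow> stores A ''top'' (\<lambda>v. pos (last_neighbor v))"
      by (rule stores_cong) (rule top_pos_arcs)
    then show ?thesis
      using that by (simp add: top_inv_def guide_inv_def guide_pos_empty higher_count_empty)
  qed
  from scan show ?thesis by (rule terminates_mono) (simp_all add: update_top_def guide_inv)
qed

lemma wp_update_guide_count_higher:
  assumes inv: "guide_inv D (arr s)" and D: "D \<subseteq> set arcs"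
    and arc: "(reg s ''v'', reg s ''u'') \<in> set arcs - D"
  shows "wp W (Seq update_guide count_higher)
    (\<lambda>s'. guide_inv (insert (reg s ''v'', reg s ''u'') D) (arr s') \<and> reg s' = reg s) s"
proof -
  let ?D = "insert (reg s ''v'', reg s ''u'') D"
  have "reg s ''v'' < n" "reg s ''u'' < n" using arc arcs_less by blast+
  then have "wp W update_guide (updated ''guide'' (guide_pos ?D) s) s"
    using inv by (intro wp_update_guide D) (simp_all add: guide_inv_def)
  then have "wp W update_guide
      (wp W count_higher (\<lambda>s'. guide_inv ?D (arr s') \<and> reg s' = reg s)) s"
  proof (rule wp_mono)
    fix s1 assume "updated ''guide'' (guide_pos ?D) s s1"
    then have s1: "loaded (arr s1)" "stores (arr s1) ''pos'' pos"
      "stores (arr s1) ''top'' (\<lambda>v. pos (last_neighbor v))"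
      "stores (arr s1) ''guide'' (guide_pos ?D)"
      "stores (arr s1) ''higher'' (higher_count D)" and reg_s1: "reg s1 = reg s"
      using inv by (auto simp: guide_inv_def array_update elim!: updatedE)
    have "wp W count_higher (updated ''higher'' (higher_count ?D) s1) s1"
      using wp_count_higher[OF D, of s1] arc reg_s1 s1 by simp
    then show "wp W count_higher (\<lambda>s'. guide_inv ?D (arr s') \<and> reg s' = reg s) s1"
      by (rule wp_mono) (use s1 reg_s1 in \<open>auto simp: guide_inv_def array_update elim!: updatedE\<close>)
  qed
  then show ?thesis by simp
qed

lemma terminates_scan_update_guide:
  assumes "guide_inv {} (arr s)" "reg s ''n'' = n"
  shows "terminates W (scan_arcs (Seq update_guide count_higher))
    (7 + 13 * n + 41 * length (concat adj))
    (\<lambda>s'. guide_inv (set arcs) (arr s') \<and> reg s' ''n'' = n) s"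
proof -
  have "terminates W (scan_arcs (Seq update_guide count_higher))
      (7 + 13 * n + length (concat adj) * (cost (Seq update_guide count_higher) + 13))
      (\<lambda>s'. guide_inv (set arcs) (arr s') \<and> reg s' ''n'' = n) s"
    by (rule terminates_scan_arcs[where I = guide_inv, OF _ wp_update_guide_count_higher assms])
      (simp add: guide_inv_def)
  then show ?thesis by (rule terminates_mono) (simp_all add: update_guide_def count_higher_def)
qed

lemma guide_inv_update:
  "guide_inv D (A(''end1'' := f)) \<longleftrightarrow> guide_inv D A"
  "guide_inv D (A(''end2'' := f)) \<longleftrightarrow> guide_inv D A"
  by (simp_all add: guide_inv_def array_update)

lemma guide_inv_arcsD:
  assumes "guide_inv (set arcs) A" "v < n"
  shows "A ''order'' (pos v) = v" "A ''guide'' v = pos (first (guides v))"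
    "A ''top'' v = pos (last_neighbor v)" "A ''higher'' v = card (higher_neighbors v)"
  using assms pos_less_n[of v] nth_pos[of v]
  by (simp_all add: guide_inv_def loaded_def stores_def guide_pos_arcs higher_count_arcs)

lemma wp_write_parent_edge:
  assumes inv: "guide_inv (set arcs) (arr s)" and v: "v < n" and i: "reg s ''i'' = pos v"
  shows "wp W write_parent_edge Q s \<longleftrightarrow>
    Q (s\<lparr>arr := (arr s)(''end1'' := (arr s ''end1'')(pos v := v),
                        ''end2'' := (arr s ''end2'')(pos v := parent v))\<rparr>)"
proof -
  define g where "g = first (guides v)"
  have g: "g < n" using first_guide_in_V[of v] v by (simp add: g_def)
  then have parent: "last_neighbor g = parent v" "parent v < n"
    using last_neighbor_less_n[of g] by (simp_all add: parent_def g_def)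
  have bounds: "pos v \<le> W" "v \<le> W" "pos g \<le> W" "g \<le> W" "pos (parent v) \<le> W" "parent v \<le> W"
    using pos_less_n[OF v] pos_less_n[OF g] pos_less_n[OF parent(2)] v g parent(2) W by linarith+
  note vals = guide_inv_arcsD(1,2)[OF inv v, folded g_def]
    guide_inv_arcsD(1,3)[OF inv g, unfolded parent] guide_inv_arcsD(1)[OF inv parent(2)]
  show ?thesis by (simp add: write_parent_edge_def i vals bounds)
qed

lemma wp_test_higher:
  assumes inv: "guide_inv (set arcs) (arr s)" and v: "v < n"
    and reg: "reg s ''i'' = pos v" "reg s ''n'' = n"
  shows "wp W test_higher Q s \<longleftrightarrow>
    Q (if min 2 (n - Suc (pos v)) \<le> card (higher_neighbors v) then s
       else s\<lparr>reg := (reg s)(''answer'' := 0)\<rparr>)"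
proof -
  have card: "card (higher_neighbors v) \<le> n"
    using higher_count_le_n[of "set arcs" v] by (simp add: higher_count_arcs)
  have bounds: "pos v \<le> W" "Suc (pos v) \<le> W" "v \<le> W" "card (higher_neighbors v) \<le> W" "n \<le> W"
    using pos_less_n[OF v] v card W by linarith+
  show ?thesis
    using W(1) by (simp add: test_higher_def reg guide_inv_arcsD(1,4)[OF inv v] bounds
        min_le_iff_disj not_le)
qed

definition output_inv :: "nat \<Rightarrow> state \<Rightarrow> bool" where
  "output_inv i s \<longleftrightarrow> guide_inv (set arcs) (arr s) \<and> reg s ''n'' = n \<and> reg s ''i'' = i \<and>
     (\<forall>j<i. arr s ''end1'' j = vs ! j \<and> arr s ''end2'' j = parent (vs ! j)) \<and>
     reg s ''answer'' = of_bool (\<forall>j<i. min 2 (n - Suc j) \<le> card (higher_neighbors (vs ! j)))"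

lemma wp_write_output_body:
  assumes inv: "output_inv i s" and i: "i < n - 1"
  shows "wp W (Seq write_parent_edge test_higher)
    (\<lambda>s'. reg s' ''i'' = i \<and> output_inv (Suc i) (s'\<lparr>reg := (reg s')(''i'' := Suc i)\<rparr>)) s"
proof -
  have v: "vs ! i < n" "pos (vs ! i) = i"
    using i nth_less_n[of i] pos_nth[of i] length_vs_n by auto
  have guide: "guide_inv (set arcs) (arr s)" and reg: "reg s ''i'' = i" "reg s ''n'' = n"
    using inv by (simp_all add: output_inv_def)
  note edge = wp_write_parent_edge[OF guide v(1), unfolded v(2), OF reg(1)]
  note test = wp_test_higher[of _ "vs ! i", OF _ v(1), unfolded v(2)]
  show ?thesis
    using inv by (simp add: edge test guide_inv_update output_inv_def All_less_Suc)
qed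

lemma terminates_write_output:
  assumes "guide_inv (set arcs) (arr s)" "reg s ''n'' = n"
  shows "terminates W write_output (9 + 39 * n) (\<lambda>s'.
    reg s' ''answer'' = of_bool enough_higher_neighbors \<and> output_edges n s' = parent_tree) s"
proof -
  let ?init = "Seq (Assign ''answer'' (Const 1)) (Assign ''i'' (Const 0))"
  let ?end = "Minus (Reg ''n'') (Const 1)" and ?body = "Seq write_parent_edge test_higher"
  have "terminates W write_output (cost ?init + (acost ?end + 2 +
      (\<Sum>i<n-1. cost ?body + acost ?end + 6))) (output_inv (n - 1)) s"
    unfolding write_output_def
    by (rule terminates_init_for_upto[where I = output_inv,
          OF _ _ terminates_wp[OF wp_write_output_body]])
      (use assms W in \<open>auto simp: output_inv_def\<close>)
  then show ?thesis
  proof (rule terminates_mono)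
    fix s' assume inv: "output_inv (n - 1) s'"
    then have "output_edges n s' = parent_tree"
      unfolding output_edges_def parent_tree_eq_nth length_vs_n output_inv_def
      by (metis (no_types, lifting))
    then show "reg s' ''answer'' = of_bool enough_higher_neighbors \<and>
        output_edges n s' = parent_tree"
      using inv by (simp add: output_inv_def enough_higher_neighbors_iff_nth length_vs_n)
  qed (simp add: write_parent_edge_def test_higher_def)
qed

lemma terminates_lcst_program:
  "terminates W lcst_program (28 + 84 * n + 64 * length (concat adj)) (\<lambda>s.
    reg s ''answer'' = of_bool enough_higher_neighbors \<and> output_edges n s = parent_tree)
    (input_state n m adj vs)"
proof -
  have "terminates W lcst_program ((5 + 19 * n) + ((7 + 13 * n + 23 * length (concat adj)) +
      ((7 + 13 * n + 41 * length (concat adj)) + (9 + 39 * n))))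
    (\<lambda>s. reg s ''answer'' = of_bool enough_higher_neighbors \<and> output_edges n s = parent_tree)
    (input_state n m adj vs)"
    unfolding lcst_program_def
    by (intro terminates_Seq[OF terminates_index_order]
        terminates_Seq[OF terminates_scan_update_top]
        terminates_Seq[OF terminates_scan_update_guide] terminates_write_output loaded_input_state)
      (auto simp: input_state_def stores_def)
  then show ?thesis by (rule terminates_mono) simp_all
qed

lemma lcst_program_correct:
  assumes "3 \<le> n"
  shows "terminates W lcst_program (28 + 84 * n + 64 * length (concat adj))
    (\<lambda>s. if \<exists>T. locally_connected_spanning_tree {..<n} E T
      then reg s ''answer'' = 1 \<and> locally_connected_spanning_tree {..<n} E (output_edges n s)
      else reg s ''answer'' = 0)
    (input_state n m adj vs)"
proof (rule terminates_mono[OF terminates_lcst_program order.refl])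
  fix s
  assume "reg s ''answer'' = of_bool enough_higher_neighbors \<and> output_edges n s = parent_tree"
  moreover have "(\<exists>T. locally_connected_spanning_tree {..<n} E T) \<longleftrightarrow> enough_higher_neighbors"
    using ex_lcst_iff assms by simp
  moreover have "enough_higher_neighbors \<Longrightarrow> locally_connected_spanning_tree {..<n} E parent_tree"
    using lcst_parent_tree length_vs_n assms by simp
  ultimately show "if \<exists>T. locally_connected_spanning_tree {..<n} E T
      then reg s ''answer'' = 1 \<and> locally_connected_spanning_tree {..<n} E (output_edges n s)
      else reg s ''answer'' = 0" by auto
qed

end

theorem theorem1:
  shows "\<exists>(P :: com) (K :: nat).
    \<forall>(n :: nat) (m :: nat) (E :: nat set set) (vs :: nat list) (adj :: nat list list).
      3 \<le> n \<longrightarrow> m = card E \<longrightarrow>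
      simple_graph {..<n} E \<longrightarrow> strongly_chordal E \<longrightarrow>
      strong_elimination_order {..<n} E vs \<longrightarrow>
      adjacency_lists n E adj \<longrightarrow>
      (\<exists>t s. exec (K * (n + m)) P (input_state n m adj vs) t s \<and>
             t \<le> K * (n + m) \<and>
             (if \<exists>T. locally_connected_spanning_tree {..<n} E T
              then reg s ''answer'' = 1 \<and>
                   locally_connected_spanning_tree {..<n} E (output_edges n s)
              else reg s ''answer'' = 0))"
proof (rule exI[of _ lcst_program], rule exI[of _ 128], intro allI impI)
  fix n m :: nat and E :: "nat set set" and vs :: "nat list" and adj :: "nat list list"
  let ?W = "128 * (n + m)"
  assume "3 \<le> n" and "m = card E" and graph: "simple_graph {..<n} E"
    and order: "strong_elimination_order {..<n} E vs" and adj: "adjacency_lists n E adj"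
  then have arcs: "length (concat adj) = 2 * m" using length_concat_adjacency_lists by blast
  interpret lcst_input n E vs adj ?W
    by unfold_locales (use \<open>3 \<le> n\<close> graph order adj arcs in auto)
  obtain t s where "exec ?W lcst_program (input_state n m adj vs) t s"
      "t \<le> 28 + 84 * n + 64 * length (concat adj)"
      "if \<exists>T. locally_connected_spanning_tree {..<n} E T
       then reg s ''answer'' = 1 \<and> locally_connected_spanning_tree {..<n} E (output_edges n s)
       else reg s ''answer'' = 0"
    using lcst_program_correct[OF \<open>3 \<le> n\<close>, of m] by (rule terminatesE)
  moreover from this(2) have "t \<le> ?W" using arcs \<open>3 \<le> n\<close> by simp
  ultimately show "\<exists>t s. exec ?W lcst_program (input_state n m adj vs) t s \<and> t \<le> ?W \<and>
      (if \<exists>T. locally_connected_spanning_tree {..<n} E T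
       then reg s ''answer'' = 1 \<and> locally_connected_spanning_tree {..<n} E (output_edges n s)
       else reg s ''answer'' = 0)"
    by blast
qed

end
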